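(* Let $\mathcal{H}$ be a real or complex Hilbert space with $\dim\mathcal{H}=n\in\mathbb{N}$, let $\mathcal{F}=\{f_i\}_{i=1}^p\subseteq\mathcal{H}$ be a finite sequence with frame operator $S^{\mathcal{F}}$, and let $\mathbf{a}=\{a_i\}_{i\in\mathbb{N}}$ be a non-increasing sequence of positive real numbers such that $\sum_{i=1}^\infty a_i$ diverges. Let $d\in\mathbb{R}$ be an algorithmic computable upper bound for the operator norm $\|S^{\mathcal{F}}\|$ and let $c=\max(d+1,\,d+a_1)$. If $r\in\mathbb{N}$ is such that $$\sum_{i=1}^{r-1}a_i\ <\ c\cdot n-\operatorname{tr}(S^{\mathcal{F}})\ \le\ \sum_{i=1}^r a_i,$$ then there exists an algorithmic computable sequence $\mathcal{G}=\{g_i\}_{i=1}^r\subseteq\mathcal{H}$ such that $\mathcal{F}\cup\mathcal{G}$ is a tight frame for $\mathcal{H}$ and $\|g_i\|^2=a_i$ for $1\le i\le r$.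
   Context: $\mathbb{N}=\{1,2,\dots\}$. The frame operator of a finite sequence $\{f_i\}_{i=1}^p\subset\mathcal{H}$ is $Sf=\sum_{i=1}^p\langle f,f_i\rangle f_i$; the sequence is a tight frame for $\mathcal{H}$ if $S=cI$ for some $c>0$ (this $c$ need not be the number $c$ in the claim). $\mathcal{F}\cup\mathcal{G}$ denotes the concatenated sequence, with frame operator $S^{\mathcal{F}}+S^{\mathcal{G}}$. "Algorithmic computable" is to be read as: obtained from the data in a finite number of steps by an explicit procedure which uses only arithmetic operations, complex conjugation, comparisons of real numbers and square roots of non-negative reals (in particular, without diagonalizing a positive semi-definite matrix). Here the data are the coordinates of the $f_i$ in a fixed orthonormal basis of $\mathcal{H}$ and the numbers $a_i$ (and, for $\mathcal{G}$, also $d$), and the output consists of the coordinates of the $g_i$ in that basis. *)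

theory Defs
  imports Complex_Main
begin

section \<open>Real and complex scalars\<close>

text \<open>
  Real and complex Hilbert spaces are treated simultaneously by taking the scalars from the
  class below. The axioms force \<open>rc_cnj z = \<bar>z\<bar>\<^sup>2 / z\<close> for \<open>z \<noteq> 0\<close>, and a commutative real normed
  field is isometrically isomorphic to the reals or to the complex numbers (Gelfand-Mazur).
  So, up to isomorphism, the two instances given here are the only ones. A scalar counts as a
  real number when it lies in \<open>\<real>\<close>, the range of \<^const>\<open>of_real\<close>.
\<close>

class rc_field = real_normed_field +
  fixes rc_cnj :: "'a \<Rightarrow> 'a"
    and rc_re :: "'a \<Rightarrow> real"
  assumes rc_cnj_add: "rc_cnj (x + y) = rc_cnj x + rc_cnj y"
    and rc_cnj_mult: "rc_cnj (x * y) = rc_cnj x * rc_cnj y"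
    and rc_mult_cnj: "x * rc_cnj x = (norm x)\<^sup>2 *\<^sub>R 1"
    and rc_add_cnj: "x + rc_cnj x = (2 * rc_re x) *\<^sub>R 1"

instantiation real :: rc_field
begin

definition rc_cnj_real :: "real \<Rightarrow> real" where "rc_cnj_real x = x"
definition rc_re_real :: "real \<Rightarrow> real" where "rc_re_real x = x"

instance
  by standard (simp_all add: rc_cnj_real_def rc_re_real_def power2_eq_square)

end

instantiation complex :: rc_field
begin

definition rc_cnj_complex :: "complex \<Rightarrow> complex" where "rc_cnj_complex = cnj"
definition rc_re_complex :: "complex \<Rightarrow> real" where "rc_re_complex = Re"

instance
  by standard
    (simp_all add: rc_cnj_complex_def rc_re_complex_def complex_eq_iff cmod_power2 flip: power2_eq_square)

end


section \<open>Finite-dimensional Hilbert spaces and frames\<close>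

text \<open>
  Every finite-dimensional inner product space is complete, so no completeness axiom is needed
  as long as the dimension is finite.
\<close>

locale inner_product_space = vector_space scale
  for scale :: "'k::rc_field \<Rightarrow> 'h::ab_group_add \<Rightarrow> 'h" +
  fixes ip :: "'h \<Rightarrow> 'h \<Rightarrow> 'k"
  assumes ip_add_left: "ip (x + y) z = ip x z + ip y z"
    and ip_scale_left: "ip (scale c x) y = c * ip x y"
    and ip_cnj: "ip y x = rc_cnj (ip x y)"
    and ip_pos: "x \<noteq> 0 \<Longrightarrow> 0 < rc_re (ip x x)"

text \<open>
  The library's dimension is 0 for a space without a finite basis, so the condition \<open>1 \<le> n\<close>
  excludes infinite-dimensional spaces.
\<close>

definition hilbert_space_of_dim ::
  "('k::rc_field \<Rightarrow> 'h::ab_group_add \<Rightarrow> 'h) \<Rightarrow> ('h \<Rightarrow> 'h \<Rightarrow> 'k) \<Rightarrow> nat \<Rightarrow> bool" where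
  "hilbert_space_of_dim scale ip n \<longleftrightarrow>
     inner_product_space scale ip \<and> 1 \<le> n \<and> vector_space.dim scale UNIV = n"

text \<open>Finite and infinite sequences are indexed from 1; values at other indices are junk.\<close>

definition orthonormal_basis ::
  "('k::rc_field \<Rightarrow> 'h::ab_group_add \<Rightarrow> 'h) \<Rightarrow> ('h \<Rightarrow> 'h \<Rightarrow> 'k) \<Rightarrow> nat \<Rightarrow> (nat \<Rightarrow> 'h) \<Rightarrow> bool" where
  "orthonormal_basis scale ip n e \<longleftrightarrow>
     (\<forall>i\<in>{1..n}. \<forall>j\<in>{1..n}. ip (e i) (e j) = (if i = j then 1 else 0)) \<and>
     module.span scale (e ` {1..n}) = UNIV"

definition hnorm :: "('h \<Rightarrow> 'h \<Rightarrow> 'k::rc_field) \<Rightarrow> 'h \<Rightarrow> real" where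
  "hnorm ip x = sqrt (rc_re (ip x x))"

definition op_norm :: "('h \<Rightarrow> 'h \<Rightarrow> 'k::rc_field) \<Rightarrow> ('h \<Rightarrow> 'h) \<Rightarrow> real" where
  "op_norm ip T = (SUP x\<in>{x. hnorm ip x \<le> 1}. hnorm ip (T x))"

text \<open>The trace, computed in an orthonormal basis \<open>e\<close>; it does not depend on \<open>e\<close>.\<close>

definition op_trace ::
  "('h \<Rightarrow> 'h \<Rightarrow> 'k::rc_field) \<Rightarrow> nat \<Rightarrow> (nat \<Rightarrow> 'h) \<Rightarrow> ('h \<Rightarrow> 'h) \<Rightarrow> 'k" where
  "op_trace ip n e T = (\<Sum>j=1..n. ip (T (e j)) (e j))"

definition frame_operator ::
  "('k::rc_field \<Rightarrow> 'h::ab_group_add \<Rightarrow> 'h) \<Rightarrow> ('h \<Rightarrow> 'h \<Rightarrow> 'k) \<Rightarrow> nat \<Rightarrow> (nat \<Rightarrow> 'h) \<Rightarrow> 'h \<Rightarrow> 'h" where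
  "frame_operator scale ip p f x = (\<Sum>i=1..p. scale (ip x (f i)) (f i))"

definition tight_frame ::
  "('k::rc_field \<Rightarrow> 'h::ab_group_add \<Rightarrow> 'h) \<Rightarrow> ('h \<Rightarrow> 'h \<Rightarrow> 'k) \<Rightarrow> nat \<Rightarrow> (nat \<Rightarrow> 'h) \<Rightarrow> bool" where
  "tight_frame scale ip p f \<longleftrightarrow>
     (\<exists>C::real. 0 < C \<and> (\<forall>x. frame_operator scale ip p f x = scale (of_real C) x))"

definition concat_seq :: "nat \<Rightarrow> (nat \<Rightarrow> 'h) \<Rightarrow> (nat \<Rightarrow> 'h) \<Rightarrow> nat \<Rightarrow> 'h" where
  "concat_seq p f g i = (if i \<le> p then f i else g (i - p))"


section \<open>Algorithms\<close>

text \<open>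
  Algorithms are programs of a while language. A state consists of natural number variables
  (sizes, loop counters, array indices) and of named, doubly indexed arrays of scalars. On
  scalars only the arithmetic operations, conjugation, square roots of non-negative reals and
  comparisons of reals are available. The only scalar constants are 0 and 1, so no other
  number can be built into a program.
\<close>

type_synonym 'k state = "(string \<Rightarrow> nat) \<times> (string \<Rightarrow> nat \<Rightarrow> nat \<Rightarrow> 'k)"

datatype iexp =
    INum nat
  | IVar string
  | IPlus iexp iexp
  | IMinus iexp iexp
  | ITimes iexp iexp

datatype sexp =
    SZero
  | SOne
  | SElem string iexp iexp
  | SPlus sexp sexp
  | SMinus sexp sexp
  | STimes sexp sexp
  | SDivide sexp sexp
  | SCnj sexp
  | SSqrt sexp

datatype test =
    ILess iexp iexp
  | SLess sexp sexp
  | TNot test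
  | TAnd test test

datatype prog =
    Skip
  | ISet string iexp
  | SSet string iexp iexp sexp
  | Seq prog prog
  | Cond test prog prog
  | While test prog

primrec ival :: "iexp \<Rightarrow> 'k state \<Rightarrow> nat" where
  "ival (INum k) s = k"
| "ival (IVar x) s = fst s x"
| "ival (IPlus a b) s = ival a s + ival b s"
| "ival (IMinus a b) s = ival a s - ival b s"
| "ival (ITimes a b) s = ival a s * ival b s"

primrec sval :: "sexp \<Rightarrow> 'k::rc_field state \<Rightarrow> 'k" where
  "sval SZero s = 0"
| "sval SOne s = 1"
| "sval (SElem A i j) s = snd s A (ival i s) (ival j s)"
| "sval (SPlus a b) s = sval a s + sval b s"
| "sval (SMinus a b) s = sval a s - sval b s"
| "sval (STimes a b) s = sval a s * sval b s"
| "sval (SDivide a b) s = sval a s / sval b s"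
| "sval (SCnj a) s = rc_cnj (sval a s)"
| "sval (SSqrt a) s = of_real (sqrt (rc_re (sval a s)))"

text \<open>
  Division by zero, the square root of anything but a non-negative real, and the comparison of
  scalars that are not real are illegal: a program that attempts one of them gets stuck.
\<close>

primrec sdefined :: "sexp \<Rightarrow> 'k::rc_field state \<Rightarrow> bool" where
  "sdefined SZero s = True"
| "sdefined SOne s = True"
| "sdefined (SElem A i j) s = True"
| "sdefined (SPlus a b) s = (sdefined a s \<and> sdefined b s)"
| "sdefined (SMinus a b) s = (sdefined a s \<and> sdefined b s)"
| "sdefined (STimes a b) s = (sdefined a s \<and> sdefined b s)"
| "sdefined (SDivide a b) s = (sdefined a s \<and> sdefined b s \<and> sval b s \<noteq> 0)"
| "sdefined (SCnj a) s = sdefined a s"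
| "sdefined (SSqrt a) s = (sdefined a s \<and> sval a s \<in> \<real> \<and> 0 \<le> rc_re (sval a s))"

primrec tval :: "test \<Rightarrow> 'k::rc_field state \<Rightarrow> bool" where
  "tval (ILess a b) s = (ival a s < ival b s)"
| "tval (SLess a b) s = (rc_re (sval a s) < rc_re (sval b s))"
| "tval (TNot t) s = (\<not> tval t s)"
| "tval (TAnd t u) s = (tval t s \<and> tval u s)"

primrec tdefined :: "test \<Rightarrow> 'k::rc_field state \<Rightarrow> bool" where
  "tdefined (ILess a b) s = True"
| "tdefined (SLess a b) s =
     (sdefined a s \<and> sdefined b s \<and> sval a s \<in> \<real> \<and> sval b s \<in> \<real>)"
| "tdefined (TNot t) s = tdefined t s"
| "tdefined (TAnd t u) s = (tdefined t s \<and> tdefined u s)"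

text \<open>
  \<open>exec P s t\<close>: started in \<open>s\<close>, the program \<open>P\<close> halts after finitely many steps, all of them
  legal, in the state \<open>t\<close>.
\<close>

inductive exec :: "prog \<Rightarrow> 'k::rc_field state \<Rightarrow> 'k state \<Rightarrow> bool" where
  Skip: "exec Skip s s"
| ISet: "exec (ISet x a) s ((fst s)(x := ival a s), snd s)"
| SSet: "sdefined a s \<Longrightarrow>
    exec (SSet A i j a) s
      (fst s, (snd s)(A := (snd s A)(ival i s := (snd s A (ival i s))(ival j s := sval a s))))"
| Seq: "exec P s t \<Longrightarrow> exec Q t u \<Longrightarrow> exec (Seq P Q) s u"
| CondTrue: "tdefined b s \<Longrightarrow> tval b s \<Longrightarrow> exec P s t \<Longrightarrow> exec (Cond b P Q) s t"
| CondFalse: "tdefined b s \<Longrightarrow> \<not> tval b s \<Longrightarrow> exec Q s t \<Longrightarrow> exec (Cond b P Q) s t"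
| WhileFalse: "tdefined b s \<Longrightarrow> \<not> tval b s \<Longrightarrow> exec (While b P) s s"
| WhileTrue: "tdefined b s \<Longrightarrow> tval b s \<Longrightarrow> exec P s t \<Longrightarrow> exec (While b P) t u \<Longrightarrow>
    exec (While b P) s u"

inductive_cases exec_SkipE: "exec Skip s t"
inductive_cases exec_ISetE: "exec (ISet x a) s t"
inductive_cases exec_SSetE: "exec (SSet A i j a) s t"
inductive_cases exec_SeqE: "exec (Seq P Q) s t"
inductive_cases exec_CondE: "exec (Cond b P Q) s t"
inductive_cases exec_WhileE: "exec (While b P) s t"

lemma exec_deterministic: "exec P s t \<Longrightarrow> exec P s u \<Longrightarrow> u = t"
proof (induction arbitrary: u rule: exec.induct)
  case (Skip s)
  then show ?case by (rule exec_SkipE)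
next
  case (ISet x a s)
  then show ?case by (rule exec_ISetE)
next
  case (SSet a s A i j)
  from SSet.prems show ?case by (rule exec_SSetE)
next
  case (Seq P s t Q u')
  from Seq.prems obtain t' where "exec P s t'" "exec Q t' u" by (rule exec_SeqE)
  with Seq.IH(1)[of t'] Seq.IH(2)[of u] show ?case by simp
next
  case (CondTrue b s P t Q)
  from CondTrue.prems have "exec P s u" by (rule exec_CondE) (use CondTrue.hyps in simp_all)
  then show ?case by (rule CondTrue.IH)
next
  case (CondFalse b s Q t P)
  from CondFalse.prems have "exec Q s u" by (rule exec_CondE) (use CondFalse.hyps in simp_all)
  then show ?case by (rule CondFalse.IH)
next
  case (WhileFalse b s P)
  from WhileFalse.prems show ?case by (rule exec_WhileE) (use WhileFalse.hyps in simp_all)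
next
  case (WhileTrue b s P t u')
  from WhileTrue.prems obtain t' where "exec P s t'" "exec (While b P) t' u"
    by (rule exec_WhileE) (use WhileTrue.hyps in simp_all)
  with WhileTrue.IH(1)[of t'] WhileTrue.IH(2)[of u] show ?case by simp
qed

text \<open>
  The initial state for the data \<open>x\<close> (the coordinates \<open>x i j\<close> of \<open>p\<close> vectors in dimension \<open>n\<close>)
  and \<open>a\<close>. The sizes \<open>n\<close>, \<open>p\<close> are the values of the variables \<open>''n''\<close>, \<open>''p''\<close>, and the numbers
  \<open>a i\<close> are stored in column 0 of the array \<open>''a''\<close>. Everything else is 0. A halting run
  reads only finitely many of the \<open>a i\<close>.
\<close>

definition input :: "nat \<Rightarrow> nat \<Rightarrow> (nat \<Rightarrow> nat \<Rightarrow> 'k) \<Rightarrow> (nat \<Rightarrow> real) \<Rightarrow> 'k::rc_field state" where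
  "input n p x a =
     ((\<lambda>v. if v = ''n'' then n else if v = ''p'' then p else 0),
      (\<lambda>A i j.
         if A = ''f'' \<and> i \<in> {1..p} \<and> j \<in> {1..n} then x i j
         else if A = ''a'' \<and> 1 \<le> i \<and> j = 0 then of_real (a i)
         else 0))"

text \<open>The same data together with \<open>d\<close>, stored in entry (0, 0) of the array \<open>''d''\<close>.\<close>

definition input_with ::
  "nat \<Rightarrow> nat \<Rightarrow> (nat \<Rightarrow> nat \<Rightarrow> 'k) \<Rightarrow> (nat \<Rightarrow> real) \<Rightarrow> real \<Rightarrow> 'k::rc_field state" where
  "input_with n p x a d =
     (fst (input n p x a),
      (\<lambda>A i j. if A = ''d'' \<and> i = 0 \<and> j = 0 then of_real d else snd (input n p x a) A i j))"

definition computes_real :: "prog \<Rightarrow> 'k::rc_field state \<Rightarrow> real \<Rightarrow> bool" where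
  "computes_real P s d \<longleftrightarrow> (\<exists>t. exec P s t \<and> snd t ''d'' 0 0 = of_real d)"

text \<open>The output is a sequence of \<open>r\<close> vectors in dimension \<open>n\<close>: its length and its coordinates.\<close>

definition computes_vectors ::
  "prog \<Rightarrow> 'k::rc_field state \<Rightarrow> nat \<Rightarrow> nat \<Rightarrow> (nat \<Rightarrow> nat \<Rightarrow> 'k) \<Rightarrow> bool" where
  "computes_vectors P s r n y \<longleftrightarrow>
     (\<exists>t. exec P s t \<and> fst t ''r'' = r \<and>
        (\<forall>i\<in>{1..r}. \<forall>j\<in>{1..n}. snd t ''g'' i j = y i j))"

end

theory Submission
  imports Defs
begin

text \<open>
  Let \<open>S\<close> be the frame operator of the given vectors and let \<open>C = (a 1 + \<dots> + a r + tr S) / n\<close>.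
  Adding vectors \<open>g q\<close> makes the frame tight with constant \<open>C\<close> exactly if the sum of the dyads
  \<open>g q g q\<^sup>*\<close> is the matrix \<open>A = C I - S\<close>. The choice of \<open>r\<close> gives \<open>C \<ge> c \<ge> d + a 1\<close>, and
  \<open>S \<le> d I\<close>, so \<open>A\<close> is bounded below by \<open>a 1\<close>; its trace is \<open>a 1 + \<dots> + a r\<close>. It remains to
  write such a matrix as a sum of dyads of vectors with the squared lengths \<open>a 1, \<dots>, a r\<close>, all
  of them at most \<open>a 1\<close>, without knowing the eigenvectors of \<open>A\<close>.

  The eigenvectors are replaced by the columns of an incremental Cholesky factorization. If \<open>B\<close>
  has vanishing rows and columns up to index \<open>k\<close> and is bounded below by \<open>a 1\<close> on the
  remaining coordinates, then \<open>w = B e\<^sub>K / sqrt B\<^sub>K\<^sub>K\<close> with \<open>K = k + 1\<close> satisfies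
  \<open>\<bar>w\<bar>\<^sup>2 \<ge> B\<^sub>K\<^sub>K \<ge> a 1\<close>, and \<open>B - w w\<^sup>*\<close>, a Schur complement, has the same
  property with \<open>K\<close> in place of \<open>k\<close> (\<open>trailing_peel\<close>). So there is a supply of vectors that are
  long enough.

  Before the \<open>i\<close>-th step there are vectors \<open>g q\<close> for \<open>q < i\<close>, one leftover vector \<open>v\<close> and a
  matrix \<open>B\<close> as above such that \<open>A\<close> is the sum of the dyads of the \<open>g q\<close> and of \<open>v\<close> and of \<open>B\<close>
  (\<open>partial_decomposition\<close>). If \<open>\<bar>v\<bar>\<^sup>2 < a i\<close>, comparing traces shows that \<open>B\<close> is
  not yet exhausted, and a vector \<open>w\<close> is peeled off. Otherwise \<open>v\<close> itself is long enough and is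
  paired with the zero vector. Either way there are a short vector \<open>u\<close> and a long vector \<open>w\<close>
  with \<open>\<bar>u\<bar>\<^sup>2 < a i \<le> \<bar>w\<bar>\<^sup>2\<close>. A real rotation of the pair preserves
  \<open>u u\<^sup>* + w w\<^sup>*\<close>, and the slope for which one of the rotated vectors has squared length \<open>a i\<close> is
  the root of a real quadratic equation (\<open>rot_slope_root\<close>). That vector becomes \<open>g i\<close>, the other
  one is the new leftover. After \<open>r\<close> steps the trace is used up, so \<open>v\<close> and \<open>B\<close> vanish
  (\<open>partial_decomposition_complete\<close>).

  Every step uses field operations, conjugation, comparisons of reals and real square roots of
  numbers that are non-negative by these estimates, so the construction is a program
  (\<open>computes_Complete\<close>).
\<close>

section \<open>Conjugation and real parts\<close>

lemma rc_cnj_0 [simp]: "rc_cnj (0::'k::rc_field) = 0"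
  using rc_cnj_add[of "0::'k" 0] by simp

lemma rc_mult_cnj_of_real: "x * rc_cnj x = of_real ((norm x)\<^sup>2)" for x :: "'k::rc_field"
  using rc_mult_cnj[of x] by (simp add: of_real_def)

lemma rc_cnj_mult_of_real: "rc_cnj x * x = of_real ((norm x)\<^sup>2)" for x :: "'k::rc_field"
  using rc_mult_cnj_of_real[of x] by (simp add: mult.commute)

lemma rc_add_cnj_of_real: "x + rc_cnj x = of_real (2 * rc_re x)" for x :: "'k::rc_field"
  using rc_add_cnj[of x] by (simp add: of_real_def)

lemma norm_rc_cnj [simp]: "norm (rc_cnj x) = norm x" for x :: "'k::rc_field"
proof (cases "x = 0")
  case False
  have "norm x * norm (rc_cnj x) = norm x * norm x"
    using arg_cong[OF rc_mult_cnj_of_real[of x], of norm]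
    by (simp add: norm_mult power2_eq_square)
  with False show ?thesis by simp
qed simp

text \<open>
  Conjugation is not assumed to be an involution; it is one because it preserves the norm and
  \<open>x\<close> times its conjugate is the squared norm of \<open>x\<close>, which determines the conjugate.
\<close>

lemma rc_cnj_cnj [simp]: "rc_cnj (rc_cnj x) = x" for x :: "'k::rc_field"
proof (cases "x = 0")
  case False
  then have "rc_cnj x \<noteq> 0" using norm_rc_cnj[of x] by (metis norm_eq_zero)
  moreover have "rc_cnj x * rc_cnj (rc_cnj x) = rc_cnj x * x"
    using rc_mult_cnj_of_real[of x] rc_mult_cnj_of_real[of "rc_cnj x"] by (simp add: mult.commute)
  ultimately show ?thesis by simp
qed simp

lemma rc_cnj_of_real [simp]: "rc_cnj (of_real t) = (of_real t :: 'k::rc_field)"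
proof (cases "t = 0")
  case False
  have "of_real t * rc_cnj (of_real t :: 'k) = of_real t * of_real t"
    by (subst rc_mult_cnj_of_real) (simp add: power2_eq_square flip: of_real_mult)
  with False show ?thesis by simp
qed simp

lemma rc_cnj_1 [simp]: "rc_cnj (1::'k::rc_field) = 1"
  using rc_cnj_of_real[of 1, where 'k='k] by simp

lemma rc_cnj_minus [simp]: "rc_cnj (- x) = - rc_cnj x" for x :: "'k::rc_field"
  using rc_cnj_add[of x "- x"] by (simp add: minus_unique)

lemma rc_cnj_diff: "rc_cnj (x - y) = rc_cnj x - rc_cnj y" for x y :: "'k::rc_field"
  using rc_cnj_add[of x "- y"] by simp

lemma rc_cnj_divide: "rc_cnj (x / y) = rc_cnj x / rc_cnj y" for x y :: "'k::rc_field"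
proof (cases "y = 0")
  case False
  then have "rc_cnj y \<noteq> 0" using norm_rc_cnj[of y] by (metis norm_eq_zero)
  moreover have "rc_cnj (x / y) * rc_cnj y = rc_cnj x"
    using False by (simp flip: rc_cnj_mult)
  ultimately show ?thesis by (simp add: nonzero_eq_divide_eq)
qed simp

lemma rc_cnj_sum: "rc_cnj (\<Sum>i\<in>I. x i) = (\<Sum>i\<in>I. rc_cnj (x i :: 'k::rc_field))"
  by (induction I rule: infinite_finite_induct) (simp_all add: rc_cnj_add)

lemma rc_re_of_real [simp]: "rc_re (of_real t :: 'k::rc_field) = t"
proof -
  have "of_real (2 * t) = (of_real (2 * rc_re (of_real t :: 'k)) :: 'k)"
    using rc_add_cnj_of_real[of "of_real t :: 'k"] by simp
  then have "2 * t = 2 * rc_re (of_real t :: 'k)" by (simp only: of_real_eq_iff)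
  then show ?thesis by simp
qed

lemma rc_re_0 [simp]: "rc_re (0 :: 'k::rc_field) = 0"
  using rc_re_of_real[of 0, where 'k='k] by simp

lemma rc_re_1 [simp]: "rc_re (1 :: 'k::rc_field) = 1"
  using rc_re_of_real[of 1, where 'k='k] by simp

lemma rc_re_add: "rc_re (x + y) = rc_re x + rc_re y" for x y :: "'k::rc_field"
proof -
  have "of_real (2 * rc_re (x + y)) = (of_real (2 * (rc_re x + rc_re y)) :: 'k)"
    unfolding rc_add_cnj_of_real[symmetric] rc_cnj_add distrib_left of_real_add by simp
  then have "2 * rc_re (x + y) = 2 * (rc_re x + rc_re y)" by (simp only: of_real_eq_iff)
  then show ?thesis by simp
qed

lemma rc_re_sum: "rc_re (\<Sum>i\<in>I. x i) = (\<Sum>i\<in>I. rc_re (x i :: 'k::rc_field))"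
  by (induction I rule: infinite_finite_induct) (simp_all add: rc_re_add)

lemma rc_re_of_real_mult [simp]: "rc_re (of_real t * x) = t * rc_re x" for x :: "'k::rc_field"
proof -
  have "of_real (2 * rc_re (of_real t * x)) = (of_real (2 * (t * rc_re x)) :: 'k)"
    unfolding rc_add_cnj_of_real[symmetric] rc_cnj_mult rc_cnj_of_real
    using rc_add_cnj_of_real[of x] by (simp add: mult.left_commute flip: distrib_left)
  then have "2 * rc_re (of_real t * x) = 2 * (t * rc_re x)" by (simp only: of_real_eq_iff)
  then show ?thesis by simp
qed

lemma rc_re_minus [simp]: "rc_re (- x) = - rc_re x" for x :: "'k::rc_field"
  using rc_re_add[of x "- x"] by simp

lemma rc_re_diff: "rc_re (x - y) = rc_re x - rc_re y" for x y :: "'k::rc_field"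
  using rc_re_add[of x "- y"] by simp

lemma rc_self_adjoint_real: "rc_cnj x = x \<Longrightarrow> x = of_real (rc_re x)" for x :: "'k::rc_field"
  using rc_add_cnj_of_real[of x] by (simp flip: mult_2)

lemma rc_re_le_norm: "rc_re x \<le> norm x" for x :: "'k::rc_field"
proof -
  have "2 * rc_re x \<le> norm (x + rc_cnj x)"
    unfolding rc_add_cnj_of_real by (metis abs_ge_self norm_of_real)
  also have "\<dots> \<le> 2 * norm x" using norm_triangle_ineq[of x "rc_cnj x"] by simp
  finally show ?thesis by simp
qed

lemma rc_norm_add_sq:
  "(norm (of_real s * x + of_real t * y))\<^sup>2
     = s\<^sup>2 * (norm x)\<^sup>2 + 2 * s * t * rc_re (x * rc_cnj y) + t\<^sup>2 * (norm y)\<^sup>2"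
  for x y :: "'k::rc_field"
proof -
  have "(of_real ((norm (of_real s * x + of_real t * y))\<^sup>2) :: 'k)
      = of_real (s\<^sup>2) * (x * rc_cnj x) + of_real (s * t) * (x * rc_cnj y + rc_cnj (x * rc_cnj y))
        + of_real (t\<^sup>2) * (y * rc_cnj y)"
    unfolding rc_mult_cnj_of_real[symmetric] rc_cnj_add rc_cnj_mult rc_cnj_of_real rc_cnj_cnj
    by (simp add: algebra_simps power2_eq_square)
  also have "\<dots> = of_real (s\<^sup>2 * (norm x)\<^sup>2 + 2 * s * t * rc_re (x * rc_cnj y) + t\<^sup>2 * (norm y)\<^sup>2)"
    unfolding rc_mult_cnj_of_real rc_add_cnj_of_real by (simp add: algebra_simps)
  finally show ?thesis by (simp only: of_real_eq_iff)
qed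


section \<open>Peeling rank one matrices off a positive definite matrix\<close>

definition sq_norm :: "nat \<Rightarrow> (nat \<Rightarrow> 'k::rc_field) \<Rightarrow> real" where
  "sq_norm n x = (\<Sum>j=1..n. (norm (x j))\<^sup>2)"

definition qform :: "nat \<Rightarrow> (nat \<Rightarrow> nat \<Rightarrow> 'k::rc_field) \<Rightarrow> (nat \<Rightarrow> 'k) \<Rightarrow> real" where
  "qform n B x = rc_re (\<Sum>i=1..n. \<Sum>j=1..n. rc_cnj (x i) * B i j * x j)"

text \<open>
  The shape of what remains of a positive definite Hermitian matrix after \<open>k\<close> steps of the
  Cholesky factorization. The lower bound \<open>m\<close> concerns only vectors supported beyond \<open>k\<close>. Matrices
  are indexed from 1, and entries outside the range \<open>{1..n}\<close> are ignored, since they are junk in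
  the arrays of a program.
\<close>

definition trailing_bounded_below ::
    "nat \<Rightarrow> nat \<Rightarrow> real \<Rightarrow> (nat \<Rightarrow> nat \<Rightarrow> 'k::rc_field) \<Rightarrow> bool" where
  "trailing_bounded_below n k m B \<longleftrightarrow>
     (\<forall>i\<in>{1..n}. \<forall>j\<in>{1..n}. B j i = rc_cnj (B i j)) \<and>
     (\<forall>i\<in>{1..n}. \<forall>j\<in>{1..n}. i \<le> k \<or> j \<le> k \<longrightarrow> B i j = 0) \<and>
     (\<forall>x. (\<forall>j\<in>{1..k}. x j = 0) \<longrightarrow> m * sq_norm n x \<le> qform n B x)"

lemma trailing_bounded_belowD:
  assumes "trailing_bounded_below n k m B"
  shows "i \<in> {1..n} \<Longrightarrow> j \<in> {1..n} \<Longrightarrow> B j i = rc_cnj (B i j)"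
    and "i \<in> {1..n} \<Longrightarrow> j \<in> {1..n} \<Longrightarrow> i \<le> k \<or> j \<le> k \<Longrightarrow> B i j = 0"
    and "(\<And>j. j \<in> {1..k} \<Longrightarrow> x j = 0) \<Longrightarrow> m * sq_norm n x \<le> qform n B x"
  using assms unfolding trailing_bounded_below_def by blast+

lemma trailing_bounded_below_cong:
  assumes "\<And>i j. i \<in> {1..n} \<Longrightarrow> j \<in> {1..n} \<Longrightarrow> B i j = B' i j"
  shows "trailing_bounded_below n k m B \<longleftrightarrow> trailing_bounded_below n k m B'"
proof -
  have "qform n B = qform n B'"
    unfolding qform_def fun_eq_iff
    by (intro allI arg_cong[of _ _ rc_re] sum.cong refl) (simp add: assms)
  moreover have "(\<forall>i\<in>{1..n}. \<forall>j\<in>{1..n}. B j i = rc_cnj (B i j))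
      \<longleftrightarrow> (\<forall>i\<in>{1..n}. \<forall>j\<in>{1..n}. B' j i = rc_cnj (B' i j))"
    by (intro ball_cong refl) (metis assms)
  moreover have "(\<forall>i\<in>{1..n}. \<forall>j\<in>{1..n}. i \<le> k \<or> j \<le> k \<longrightarrow> B i j = 0)
      \<longleftrightarrow> (\<forall>i\<in>{1..n}. \<forall>j\<in>{1..n}. i \<le> k \<or> j \<le> k \<longrightarrow> B' i j = 0)"
    by (intro ball_cong refl) (simp add: assms)
  ultimately show ?thesis unfolding trailing_bounded_below_def by (simp only:)
qed

lemma sq_norm_nonneg: "0 \<le> sq_norm n x"
  by (simp add: sq_norm_def sum_nonneg)

lemma sq_norm_eq_0: "sq_norm n x = 0 \<longleftrightarrow> (\<forall>j\<in>{1..n}. x j = 0)"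
  by (simp add: sq_norm_def sum_nonneg_eq_0_iff)

lemma of_real_sq_norm: "of_real (sq_norm n x) = (\<Sum>j=1..n. x j * rc_cnj (x j))"
  by (simp add: sq_norm_def rc_mult_cnj_of_real)

text \<open>
  The diagonal entry is the value of the form at a unit vector. It is the next pivot, so the
  factorization never divides by zero.
\<close>

lemma trailing_diag:
  assumes B: "trailing_bounded_below n k m B" and j: "k < j" "j \<le> n"
  shows "B j j = of_real (rc_re (B j j))" "m \<le> rc_re (B j j)"
proof -
  show "B j j = of_real (rc_re (B j j))"
    using j by (intro rc_self_adjoint_real trailing_bounded_belowD(1)[OF B, symmetric]) auto
  let ?x = "\<lambda>i. if i = j then 1 else 0 :: 'a"
  have *: "(\<Sum>i=1..n. if i = j then y i else 0) = y j" for y :: "nat \<Rightarrow> 'b::comm_monoid_add"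
    using j by simp
  have "(\<Sum>i=1..n. \<Sum>l=1..n. rc_cnj (?x i) * B i l * ?x l)
      = (\<Sum>i=1..n. if i = j then (\<Sum>l=1..n. if l = j then B i l else 0) else 0)"
    by (intro sum.cong refl) (simp add: if_distrib cong: if_cong)
  then have "qform n B ?x = rc_re (B j j)"
    unfolding qform_def * by simp
  moreover have "sq_norm n ?x = (\<Sum>i=1..n. if i = j then 1 else 0)"
    unfolding sq_norm_def by (intro sum.cong) auto
  then have "sq_norm n ?x = 1" unfolding * .
  ultimately show "m \<le> rc_re (B j j)"
    using trailing_bounded_belowD(3)[OF B, of ?x] j by simp
qed

text \<open>
  One step of the Cholesky factorization. The form of a Schur complement at \<open>x\<close> is the form of
  the original matrix at a vector that agrees with \<open>x\<close> in all coordinates where \<open>x\<close> may be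
  non-zero, hence is at least as long as \<open>x\<close>; so a lower bound is inherited. The vector split
  off is long because its \<open>K\<close>-th entry alone has the pivot as its squared modulus.
\<close>

lemma trailing_peel:
  fixes B :: "nat \<Rightarrow> nat \<Rightarrow> 'k::rc_field"
  assumes B: "trailing_bounded_below n k m B" and k: "k < n" and m: "0 < m"
    and w: "\<And>j. j \<in> {1..n} \<Longrightarrow> w j = B j (Suc k) / of_real (sqrt (rc_re (B (Suc k) (Suc k))))"
    and B': "\<And>i j. i \<in> {1..n} \<Longrightarrow> j \<in> {1..n} \<Longrightarrow> B' i j = B i j - w i * rc_cnj (w j)"
  shows "trailing_bounded_below n (Suc k) m B'" "m \<le> sq_norm n w"
proof -
  define K where "K = Suc k"
  define b where "b = rc_re (B K K)"
  have K: "K \<in> {1..n}" using k by (simp add: K_def)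
  have bK: "B K K = of_real b" and mb: "m \<le> b"
    using trailing_diag[OF B, of K] k by (auto simp: K_def b_def)
  have b0: "0 < b" using m mb by simp
  have herm: "B j i = rc_cnj (B i j)" if "i \<in> {1..n}" "j \<in> {1..n}" for i j
    using trailing_bounded_belowD(1)[OF B that] .
  have zero: "B i j = 0" if "i \<in> {1..n}" "j \<in> {1..n}" "i < K \<or> j < K" for i j
    using trailing_bounded_belowD(2)[OF B that(1,2)] that(3) by (auto simp: K_def)
  have sqb: "of_real (sqrt b) * of_real (sqrt b) = (of_real b :: 'k)"
    using b0 by (simp flip: of_real_mult)
  have ww: "w i * rc_cnj (w j) = B i K * B K j / of_real b" if "i \<in> {1..n}" "j \<in> {1..n}" for i j
    using w[OF that(1)] w[OF that(2)] herm[OF that(2) K] sqb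
    by (simp add: rc_cnj_divide b_def K_def)
  have B'': "B' i j = B i j - B i K * B K j / of_real b" if "i \<in> {1..n}" "j \<in> {1..n}" for i j
    using B'[OF that] ww[OF that] by simp
  have "m * sq_norm n x \<le> qform n B' x" if x: "\<forall>j\<in>{1..Suc k}. x j = 0" for x
  proof -
    have xK: "x K = 0" using x by (simp add: K_def)
    \<comment> \<open>Moving \<open>x\<close> along the \<open>K\<close>-th axis so that \<open>B\<close> maps it to a vector with vanishing \<open>K\<close>-th
      entry turns the form of the Schur complement into the form of \<open>B\<close>.\<close>
    define t where "t = (\<Sum>j=1..n. B K j * x j) / of_real b"
    define y where "y = x(K := - t)"
    have By: "(\<Sum>j=1..n. B i j * y j) = (\<Sum>j=1..n. B i j * x j) - B i K * t" if "i \<in> {1..n}" for i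
    proof -
      have "(\<Sum>j=1..n. B i j * y j) = (\<Sum>j=1..n. B i j * x j - (if j = K then B i K * t else 0))"
        by (intro sum.cong) (auto simp: y_def xK)
      then show ?thesis using K by (simp add: sum_subtractf)
    qed
    have ByK: "(\<Sum>j=1..n. B K j * y j) = 0"
      using By[OF K] b0 by (simp add: bK t_def)
    have "(\<Sum>i=1..n. \<Sum>j=1..n. rc_cnj (y i) * B i j * y j)
        = (\<Sum>i=1..n. rc_cnj (y i) * (\<Sum>j=1..n. B i j * y j))"
      by (simp add: sum_distrib_left mult.assoc)
    also have "\<dots> = (\<Sum>i=1..n. rc_cnj (x i) * ((\<Sum>j=1..n. B i j * x j) - B i K * t))"
    proof (intro sum.cong refl)
      fix i assume i: "i \<in> {1..n}"
      show "rc_cnj (y i) * (\<Sum>j=1..n. B i j * y j)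
          = rc_cnj (x i) * ((\<Sum>j=1..n. B i j * x j) - B i K * t)"
      proof (cases "i = K")
        case True
        then show ?thesis using ByK by (simp add: xK)
      next
        case False
        then show ?thesis unfolding By[OF i] by (simp add: y_def)
      qed
    qed
    also have "\<dots> = (\<Sum>i=1..n. \<Sum>j=1..n. rc_cnj (x i) * B' i j * x j)"
    proof (intro sum.cong refl)
      fix i assume i: "i \<in> {1..n}"
      have "(\<Sum>j=1..n. rc_cnj (x i) * B' i j * x j)
          = (\<Sum>j=1..n. rc_cnj (x i) * (B i j * x j) - rc_cnj (x i) * (B i K * (B K j * x j / of_real b)))"
        by (intro sum.cong refl) (simp add: B''[OF i] algebra_simps)
      then show "rc_cnj (x i) * ((\<Sum>j=1..n. B i j * x j) - B i K * t)
          = (\<Sum>j=1..n. rc_cnj (x i) * B' i j * x j)"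
        by (simp add: sum_subtractf t_def right_diff_distrib sum_divide_distrib sum_distrib_left)
    qed
    finally have q: "qform n B y = qform n B' x" unfolding qform_def by simp
    have "sq_norm n x \<le> sq_norm n y"
      unfolding sq_norm_def by (intro sum_mono) (auto simp: y_def xK)
    then have "m * sq_norm n x \<le> m * sq_norm n y" using m by simp
    also have "\<dots> \<le> qform n B y"
    proof -
      have "y j = 0" if "j \<in> {1..k}" for j using x that by (auto simp: y_def K_def)
      then show ?thesis by (rule trailing_bounded_belowD(3)[OF B])
    qed
    finally show ?thesis by (simp add: q)
  qed
  moreover have "B' j i = rc_cnj (B' i j)" if "i \<in> {1..n}" "j \<in> {1..n}" for i j
    using B'[OF that] B'[OF that(2,1)] herm[OF that]
    by (simp add: rc_cnj_diff rc_cnj_mult mult.commute)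
  moreover have "B' i j = 0" if "i \<in> {1..n}" "j \<in> {1..n}" "i \<le> K \<or> j \<le> K" for i j
  proof -
    from that(3) have "(i < K \<or> j < K) \<or> i = K \<or> j = K" by linarith
    then consider "i < K \<or> j < K" | "i = K" | "j = K" by blast
    then show ?thesis
    proof cases
      case 1
      then have "B i j = 0" "B i K * B K j = 0" using that K by (auto intro!: zero)
      then show ?thesis by (simp add: B''[OF that(1,2)])
    next
      case 2
      then show ?thesis using b0 B''[OF that(1,2)] by (simp add: bK)
    next
      case 3
      then show ?thesis using b0 B''[OF that(1,2)] by (simp add: bK)
    qed
  qed
  ultimately show "trailing_bounded_below n (Suc k) m B'"
    unfolding trailing_bounded_below_def K_def by blast
  have "(norm (w K))\<^sup>2 = b"
  proof -
    have "of_real ((norm (w K))\<^sup>2) = (of_real b :: 'k)"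
      unfolding rc_mult_cnj_of_real[symmetric] using ww[OF K K] b0 by (simp add: bK)
    then show ?thesis by (simp only: of_real_eq_iff)
  qed
  moreover have "(norm (w K))\<^sup>2 \<le> sq_norm n w"
    unfolding sq_norm_def using K by (intro member_le_sum) auto
  ultimately show "m \<le> sq_norm n w" using mb by simp
qed


section \<open>Rotating two vectors so that one of them gets a prescribed length\<close>

text \<open>
  For vectors of squared lengths \<open>\<mu> < \<alpha> \<le> \<nu>\<close> whose inner product has real part \<open>h\<close>,
  this is the larger root \<open>s\<close> of \<open>(\<alpha> - \<mu>) s\<^sup>2 - 2 h s - (\<nu> - \<alpha>) = 0\<close>, which says that \<open>s\<close>
  times the short vector plus the long one has squared length \<open>\<alpha> (1 + s\<^sup>2)\<close>. The slope multiplies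
  the short vector so that the leading coefficient is strictly positive, also when \<open>\<nu> = \<alpha>\<close>;
  being real, it needs no phase factor for complex scalars.
\<close>

definition rot_slope :: "real \<Rightarrow> real \<Rightarrow> real \<Rightarrow> real \<Rightarrow> real" where
  "rot_slope \<alpha> \<mu> \<nu> h = (h + sqrt (h\<^sup>2 + (\<nu> - \<alpha>) * (\<alpha> - \<mu>))) / (\<alpha> - \<mu>)"

lemma rot_slope_root:
  assumes "\<mu> < \<alpha>" "\<alpha> \<le> \<nu>"
  shows "(rot_slope \<alpha> \<mu> \<nu> h)\<^sup>2 * \<mu> + 2 * rot_slope \<alpha> \<mu> \<nu> h * h + \<nu> = \<alpha> * (1 + (rot_slope \<alpha> \<mu> \<nu> h)\<^sup>2)"
proof -
  define D where "D = sqrt (h\<^sup>2 + (\<nu> - \<alpha>) * (\<alpha> - \<mu>))"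
  define s where "s = rot_slope \<alpha> \<mu> \<nu> h"
  have D2: "D\<^sup>2 = h\<^sup>2 + (\<nu> - \<alpha>) * (\<alpha> - \<mu>)" using assms by (simp add: D_def)
  have s: "(\<alpha> - \<mu>) * s = h + D" using assms by (simp add: s_def rot_slope_def D_def)
  have "((\<alpha> - \<mu>) * s - h)\<^sup>2 = h\<^sup>2 + (\<nu> - \<alpha>) * (\<alpha> - \<mu>)" using s D2 by simp
  then have "(\<alpha> - \<mu>) * ((\<alpha> - \<mu>) * s\<^sup>2 - 2 * s * h) = (\<alpha> - \<mu>) * (\<nu> - \<alpha>)"
    by (simp add: power2_eq_square algebra_simps)
  then have "(\<alpha> - \<mu>) * s\<^sup>2 - 2 * s * h = \<nu> - \<alpha>" using assms by simp
  then show ?thesis by (simp add: s_def[symmetric] algebra_simps)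
qed

lemma rotation_sq_norm:
  fixes u w :: "nat \<Rightarrow> 'k::rc_field"
  assumes "sq_norm n u < \<alpha>" "\<alpha> \<le> sq_norm n w"
    and s: "s = rot_slope \<alpha> (sq_norm n u) (sq_norm n w) (rc_re (\<Sum>j=1..n. u j * rc_cnj (w j)))"
    and g: "\<And>j. j \<in> {1..n} \<Longrightarrow> g j = (of_real s * u j + w j) / of_real (sqrt (1 + s\<^sup>2))"
  shows "sq_norm n g = \<alpha>"
proof -
  let ?h = "rc_re (\<Sum>j=1..n. u j * rc_cnj (w j))"
  have N: "0 < 1 + s\<^sup>2" by (simp add: add_pos_nonneg)
  have "(norm (g j))\<^sup>2
      = (s\<^sup>2 * (norm (u j))\<^sup>2 + 2 * s * rc_re (u j * rc_cnj (w j)) + (norm (w j))\<^sup>2) / (1 + s\<^sup>2)"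
    if "j \<in> {1..n}" for j
    using rc_norm_add_sq[of s "u j" 1 "w j"] N
    by (simp add: g[OF that] norm_divide power_divide)
  then have "sq_norm n g
      = (\<Sum>j=1..n. (s\<^sup>2 * (norm (u j))\<^sup>2 + 2 * s * rc_re (u j * rc_cnj (w j)) + (norm (w j))\<^sup>2) / (1 + s\<^sup>2))"
    unfolding sq_norm_def by (intro sum.cong) auto
  also have "\<dots> = (s\<^sup>2 * sq_norm n u + 2 * s * ?h + sq_norm n w) / (1 + s\<^sup>2)"
    by (simp add: sq_norm_def rc_re_sum sum.distrib sum_distrib_left flip: sum_divide_distrib)
  also have "\<dots> = \<alpha>"
    using rot_slope_root[OF assms(1,2), of ?h] N
    unfolding s[symmetric] by (simp add: nonzero_divide_eq_eq)
  finally show ?thesis .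
qed

text \<open>
  The two vectors are transformed by a real orthogonal matrix, so the sum of their dyads is
  unchanged; this is the entry of that sum at a pair of coordinates.
\<close>

lemma rotation_dyads:
  fixes u w u' w' :: "'k::rc_field"
  shows "(of_real s * u + w) / of_real (sqrt (1 + s\<^sup>2)) * rc_cnj ((of_real s * u' + w') / of_real (sqrt (1 + s\<^sup>2)))
     + (u - of_real s * w) / of_real (sqrt (1 + s\<^sup>2)) * rc_cnj ((u' - of_real s * w') / of_real (sqrt (1 + s\<^sup>2)))
     = u * rc_cnj u' + w * rc_cnj w'"
proof -
  have N: "of_real (sqrt (1 + s\<^sup>2)) * of_real (sqrt (1 + s\<^sup>2)) = (of_real (1 + s\<^sup>2) :: 'k)"
    by (simp flip: of_real_mult)
  have N0: "(of_real (1 + s\<^sup>2) :: 'k) \<noteq> 0"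
    unfolding of_real_eq_0_iff using zero_le_power2[of s] by linarith
  show ?thesis
    unfolding rc_cnj_divide rc_cnj_add rc_cnj_diff rc_cnj_mult rc_cnj_of_real times_divide_times_eq N
      add_divide_distrib[symmetric]
    by (subst nonzero_divide_eq_eq[OF N0]) (simp add: algebra_simps power2_eq_square)
qed


section \<open>Decompositions into dyads of prescribed lengths\<close>

text \<open>
  The vectors \<open>g q\<close> with \<open>q < i\<close> are final. There are two leftover vectors, of which \<open>w\<close> is zero
  between two steps and is filled in the first half of a step.
\<close>

definition partial_decomposition ::
  "nat \<Rightarrow> (nat \<Rightarrow> real) \<Rightarrow> (nat \<Rightarrow> nat \<Rightarrow> 'k::rc_field) \<Rightarrow> nat \<Rightarrow> nat \<Rightarrow>
    (nat \<Rightarrow> 'k) \<Rightarrow> (nat \<Rightarrow> 'k) \<Rightarrow> (nat \<Rightarrow> nat \<Rightarrow> 'k) \<Rightarrow> (nat \<Rightarrow> nat \<Rightarrow> 'k) \<Rightarrow> bool" where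
  "partial_decomposition n a A i k u w B g \<longleftrightarrow>
     k \<le> n \<and> trailing_bounded_below n k (a 1) B \<and>
     (\<forall>l\<in>{1..n}. \<forall>j\<in>{1..n}. A l j =
        (\<Sum>q=1..<i. g q l * rc_cnj (g q j)) + u l * rc_cnj (u j) + w l * rc_cnj (w j) + B l j) \<and>
     (\<forall>q\<in>{1..<i}. sq_norm n (g q) = a q)"

lemma partial_decomposition_trace:
  assumes "partial_decomposition n a A i k u w B g"
  shows "(\<Sum>j=1..n. rc_re (A j j))
    = (\<Sum>q=1..<i. a q) + sq_norm n u + sq_norm n w + (\<Sum>j=1..n. rc_re (B j j))"
proof -
  have A: "A j j = (\<Sum>q=1..<i. of_real ((norm (g q j))\<^sup>2)) + of_real ((norm (u j))\<^sup>2)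
      + of_real ((norm (w j))\<^sup>2) + B j j" if "j \<in> {1..n}" for j
    using assms that unfolding partial_decomposition_def rc_mult_cnj_of_real[symmetric] by blast
  have "(\<Sum>j=1..n. rc_re (A j j))
    = (\<Sum>j=1..n. (\<Sum>q=1..<i. (norm (g q j))\<^sup>2) + (norm (u j))\<^sup>2 + (norm (w j))\<^sup>2 + rc_re (B j j))"
    by (intro sum.cong refl) (simp only: A rc_re_add rc_re_sum rc_re_of_real)
  also have "\<dots> = (\<Sum>j=1..n. \<Sum>q=1..<i. (norm (g q j))\<^sup>2) + sq_norm n u + sq_norm n w + (\<Sum>j=1..n. rc_re (B j j))"
    by (simp only: sum.distrib sq_norm_def)
  also have "(\<Sum>j=1..n. \<Sum>q=1..<i. (norm (g q j))\<^sup>2) = (\<Sum>q=1..<i. sq_norm n (g q))"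
    unfolding sq_norm_def by (rule sum.swap)
  also have "\<dots> = (\<Sum>q=1..<i. a q)"
    using assms by (intro sum.cong refl) (simp add: partial_decomposition_def)
  finally show ?thesis .
qed

text \<open>
  A leftover vector shorter than required cannot exhaust the remaining trace, which is at least
  \<open>a i\<close>; so the matrix \<open>B\<close> is not zero and another vector can be peeled off it.
\<close>

lemma partial_decomposition_peel:
  assumes P: "partial_decomposition n a A i k v (\<lambda>_. 0) B g"
    and tr: "(\<Sum>j=1..n. rc_re (A j j)) = (\<Sum>q=1..r. a q)"
    and pos: "\<And>q. 1 \<le> q \<Longrightarrow> 0 < a q" and i: "i \<in> {1..r}" and small: "sq_norm n v < a i"
  shows "k < n"
    and "(\<And>j. j \<in> {1..n} \<Longrightarrow> w j = B j (Suc k) / of_real (sqrt (rc_re (B (Suc k) (Suc k))))) \<Longrightarrow>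
      (\<And>i j. i \<in> {1..n} \<Longrightarrow> j \<in> {1..n} \<Longrightarrow> B' i j = B i j - w i * rc_cnj (w j)) \<Longrightarrow>
      partial_decomposition n a A i (Suc k) v w B' g \<and> a 1 \<le> sq_norm n w"
proof -
  have kn: "k \<le> n" and B: "trailing_bounded_below n k (a 1) B"
    and A: "\<And>l j. l \<in> {1..n} \<Longrightarrow> j \<in> {1..n} \<Longrightarrow>
      A l j = (\<Sum>q=1..<i. g q l * rc_cnj (g q j)) + v l * rc_cnj (v j) + B l j"
    and nrm: "\<And>q. q \<in> {1..<i} \<Longrightarrow> sq_norm n (g q) = a q"
    using P by (auto simp: partial_decomposition_def)
  have less: "(\<Sum>q=1..<i. a q) + a i \<le> (\<Sum>q=1..r. a q)"
  proof -
    have "(\<Sum>q=1..<i. a q) + a i = (\<Sum>q=1..<Suc i. a q)"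
      using i by simp
    also have "\<dots> \<le> (\<Sum>q=1..r. a q)"
      using i by (intro sum_mono2) (auto intro: less_imp_le[OF pos])
    finally show ?thesis .
  qed
  show k: "k < n"
  proof (rule ccontr)
    assume "\<not> k < n"
    then have "B j j = 0" if "j \<in> {1..n}" for j
      using trailing_bounded_belowD(2)[OF B that that] that kn by simp
    then have "(\<Sum>j=1..n. rc_re (B j j)) = 0" by simp
    moreover have "sq_norm n (\<lambda>_. 0 :: 'a) = 0" by (simp add: sq_norm_def)
    ultimately show False
      using partial_decomposition_trace[OF P] tr less small by simp
  qed
  assume w: "\<And>j. j \<in> {1..n} \<Longrightarrow> w j = B j (Suc k) / of_real (sqrt (rc_re (B (Suc k) (Suc k))))"
    and B': "\<And>i j. i \<in> {1..n} \<Longrightarrow> j \<in> {1..n} \<Longrightarrow> B' i j = B i j - w i * rc_cnj (w j)"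
  note peel = trailing_peel[OF B k pos[of 1, OF order_refl] w B']
  show "partial_decomposition n a A i (Suc k) v w B' g \<and> a 1 \<le> sq_norm n w"
    unfolding partial_decomposition_def using peel k nrm by (auto simp: A B')
qed

text \<open>
  When the leftover vector is long enough, it takes the part of the long vector, and the
  short one is zero. This saves a separate treatment of the case without peeling.
\<close>

lemma partial_decomposition_swap:
  "partial_decomposition n a A i k v (\<lambda>_. 0) B g \<Longrightarrow> (\<And>j. j \<in> {1..n} \<Longrightarrow> w j = v j) \<Longrightarrow>
    (\<And>j. j \<in> {1..n} \<Longrightarrow> u j = 0) \<Longrightarrow> partial_decomposition n a A i k u w B g"
  by (simp add: partial_decomposition_def)

lemma partial_decomposition_rotate:
  assumes P: "partial_decomposition n a A i k u w B g" and i: "1 \<le> i"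
    and uw: "sq_norm n u < a i" "a i \<le> sq_norm n w"
    and s: "s = rot_slope (a i) (sq_norm n u) (sq_norm n w) (rc_re (\<Sum>j=1..n. u j * rc_cnj (w j)))"
    and g'i: "\<And>j. j \<in> {1..n} \<Longrightarrow> g' i j = (of_real s * u j + w j) / of_real (sqrt (1 + s\<^sup>2))"
    and u': "\<And>j. j \<in> {1..n} \<Longrightarrow> u' j = (u j - of_real s * w j) / of_real (sqrt (1 + s\<^sup>2))"
    and g': "\<And>q. q < i \<Longrightarrow> g' q = g q"
  shows "partial_decomposition n a A (Suc i) k u' (\<lambda>_. 0) B g'"
  unfolding partial_decomposition_def
proof (intro conjI ballI)
  show "k \<le> n" "trailing_bounded_below n k (a 1) B"
    using P by (auto simp: partial_decomposition_def)
next
  fix q assume "q \<in> {1..<Suc i}"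
  then consider "q = i" | "q \<in> {1..<i}" by force
  then show "sq_norm n (g' q) = a q"
  proof cases
    case 1
    show ?thesis unfolding 1 by (rule rotation_sq_norm[OF uw s g'i])
  next
    case 2
    then show ?thesis using P g'[of q] by (simp add: partial_decomposition_def)
  qed
next
  fix l j assume lj: "l \<in> {1..n}" "j \<in> {1..n}"
  have "A l j = (\<Sum>q=1..<i. g q l * rc_cnj (g q j)) + u l * rc_cnj (u j) + w l * rc_cnj (w j) + B l j"
    using P lj unfolding partial_decomposition_def by blast
  moreover have "(\<Sum>q=1..<i. g q l * rc_cnj (g q j)) = (\<Sum>q=1..<i. g' q l * rc_cnj (g' q j))"
    by (intro sum.cong refl) (simp add: g')
  moreover have "g' i l * rc_cnj (g' i j) + u' l * rc_cnj (u' j) = u l * rc_cnj (u j) + w l * rc_cnj (w j)"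
    unfolding g'i[OF lj(1)] g'i[OF lj(2)] u'[OF lj(1)] u'[OF lj(2)] by (rule rotation_dyads)
  moreover have "{1..<Suc i} = insert i {1..<i}" using i by auto
  ultimately show "A l j = (\<Sum>q=1..<Suc i. g' q l * rc_cnj (g' q j)) + u' l * rc_cnj (u' j) + 0 * rc_cnj 0 + B l j"
    by (simp add: algebra_simps)
qed

text \<open>
  By the trace, the leftover vector and the diagonal of \<open>B\<close> vanish. A coordinate beyond \<open>k\<close> would
  have a diagonal entry of at least \<open>a 1\<close>, so there is none, and \<open>B\<close> is zero.
\<close>

lemma partial_decomposition_complete:
  assumes P: "partial_decomposition n a A (Suc r) k v (\<lambda>_. 0) B g"
    and tr: "(\<Sum>j=1..n. rc_re (A j j)) = (\<Sum>q=1..r. a q)" and a1: "0 < a 1"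
    and lj: "l \<in> {1..n}" "j \<in> {1..n}"
  shows "A l j = (\<Sum>q=1..r. g q l * rc_cnj (g q j))"
proof -
  have kn: "k \<le> n" and B: "trailing_bounded_below n k (a 1) B"
    and A: "A l j = (\<Sum>q=1..r. g q l * rc_cnj (g q j)) + v l * rc_cnj (v j) + B l j"
    using P lj by (auto simp: partial_decomposition_def atLeastLessThanSuc_atLeastAtMost)
  have diag: "0 \<le> rc_re (B j j)" if "j \<in> {1..n}" for j
    using trailing_bounded_belowD(2)[OF B that that] trailing_diag(2)[OF B, of j] that a1
    by (cases "j \<le> k") auto
  have "sq_norm n v + (\<Sum>j=1..n. rc_re (B j j)) = 0"
    using partial_decomposition_trace[OF P] tr
    by (simp add: sq_norm_def atLeastLessThanSuc_atLeastAtMost)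
  then have "sq_norm n v = 0" and "(\<Sum>j=1..n. rc_re (B j j)) = 0"
    using sq_norm_nonneg[of n v] sum_nonneg[of "{1..n}" "\<lambda>j. rc_re (B j j)", OF diag] by linarith+
  then have v: "v l = 0" and Bn: "\<And>j. j \<in> {1..n} \<Longrightarrow> rc_re (B j j) = 0"
    using lj sum_nonneg_eq_0_iff[of "{1..n}" "\<lambda>j. rc_re (B j j)", OF _ diag]
    by (auto simp: sq_norm_eq_0)
  have "\<not> k < n" using trailing_diag(2)[OF B, of n] Bn[of n] a1 by auto
  then have "B l j = 0" using trailing_bounded_belowD(2)[OF B lj] lj by auto
  then show ?thesis by (simp add: A v)
qed

section \<open>Inner product spaces\<close>

context inner_product_space
begin

lemma ip_zero_left [simp]: "ip 0 y = 0"
  using ip_add_left[of 0 0 y] by simp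

lemma ip_zero_right [simp]: "ip x 0 = 0"
  using ip_cnj[of x 0] by simp

lemma ip_add_right: "ip x (y + z) = ip x y + ip x z"
  using ip_cnj[of x "y + z"] ip_cnj[of x y] ip_cnj[of x z]
  by (metis ip_add_left rc_cnj_add ip_cnj)

lemma ip_diff_left: "ip (x - y) z = ip x z - ip y z"
  using ip_add_left[of "x - y" y z] by simp

lemma ip_diff_right: "ip x (y - z) = ip x y - ip x z"
  using ip_add_right[of x "y - z" z] by simp

lemma ip_scale_right: "ip x (scale c y) = rc_cnj c * ip x y"
  by (metis ip_cnj ip_scale_left rc_cnj_mult)

lemma ip_sum_left: "ip (\<Sum>i\<in>I. x i) y = (\<Sum>i\<in>I. ip (x i) y)"
  by (induction I rule: infinite_finite_induct) (simp_all add: ip_add_left)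

lemma ip_sum_right: "ip x (\<Sum>i\<in>I. y i) = (\<Sum>i\<in>I. ip x (y i))"
  by (induction I rule: infinite_finite_induct) (simp_all add: ip_add_right)

lemma ip_self_nonneg: "0 \<le> rc_re (ip x x)"
  using ip_pos[of x] by (cases "x = 0") auto

lemma hnorm_sq: "(hnorm ip x)\<^sup>2 = rc_re (ip x x)"
  by (simp add: hnorm_def ip_self_nonneg)

lemma hnorm_nonneg: "0 \<le> hnorm ip x"
  by (simp add: hnorm_def ip_self_nonneg)

lemma hnorm_pos: "x \<noteq> 0 \<Longrightarrow> 0 < hnorm ip x"
  by (simp add: hnorm_def ip_pos)

lemma ip_self: "ip x x = of_real ((hnorm ip x)\<^sup>2)"
  unfolding hnorm_sq by (rule rc_self_adjoint_real) (metis ip_cnj)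

lemma hnorm_scale: "hnorm ip (scale c x) = norm c * hnorm ip x"
proof -
  have "ip (scale c x) (scale c x) = (c * rc_cnj c) * ip x x"
    by (simp add: ip_scale_left ip_scale_right mult_ac)
  then have "ip (scale c x) (scale c x) = of_real ((norm c)\<^sup>2) * ip x x"
    unfolding rc_mult_cnj_of_real .
  then have "(hnorm ip (scale c x))\<^sup>2 = (norm c * hnorm ip x)\<^sup>2"
    by (simp only: hnorm_sq rc_re_of_real_mult power_mult_distrib)
  then show ?thesis
    by (rule power2_eq_imp_eq) (simp_all add: hnorm_nonneg)
qed

lemma Cauchy_Schwarz: "norm (ip x y) \<le> hnorm ip x * hnorm ip y"
proof (cases "y = 0")
  case False
  define b where "b = (hnorm ip y)\<^sup>2"
  define t where "t = ip x y / of_real b"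
  have b: "0 < b" and y: "ip y y = of_real b"
    using hnorm_pos[OF False] by (simp_all add: b_def ip_self)
  define z where "z = x - scale t y"
  have "ip z y = 0"
    using b by (simp add: z_def ip_diff_left ip_scale_left y t_def)
  then have "ip z z = ip z x"
    by (subst (2) z_def) (simp add: ip_diff_right ip_scale_right)
  also have "\<dots> = ip x x - t * rc_cnj (ip x y)"
    by (simp add: z_def ip_diff_left ip_scale_left ip_cnj[of y x])
  also have "t * rc_cnj (ip x y) = of_real ((norm (ip x y))\<^sup>2 / b)"
    by (simp add: t_def rc_mult_cnj_of_real)
  finally have "rc_re (ip z z) = (hnorm ip x)\<^sup>2 - (norm (ip x y))\<^sup>2 / b"
    by (simp only: rc_re_diff rc_re_of_real hnorm_sq)
  then have "(norm (ip x y))\<^sup>2 / b \<le> (hnorm ip x)\<^sup>2"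
    using ip_self_nonneg[of z] by simp
  then have "(norm (ip x y))\<^sup>2 \<le> (hnorm ip x * hnorm ip y)\<^sup>2"
    using b by (simp add: pos_divide_le_eq power_mult_distrib b_def)
  then show ?thesis
    by (rule power2_le_imp_le) (simp add: hnorm_nonneg)
qed (simp add: hnorm_def)

lemma frame_operator_scale: "frame_operator scale ip p f (scale c x) = scale c (frame_operator scale ip p f x)"
  by (simp add: frame_operator_def ip_scale_left scale_sum_right)

lemma frame_operator_form: "ip (frame_operator scale ip p f x) y = (\<Sum>i=1..p. ip x (f i) * ip (f i) y)"
  by (simp add: frame_operator_def ip_sum_left ip_scale_left)

text \<open>
  The supremum that defines the operator norm is meaningful only for bounded operators, so a
  bound has to be found before the operator norm can be used.
\<close>

lemma frame_operator_bounded: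
  "hnorm ip (frame_operator scale ip p f x) \<le> (\<Sum>i=1..p. (hnorm ip (f i))\<^sup>2) * hnorm ip x"
proof (cases "frame_operator scale ip p f x = 0")
  case True
  then show ?thesis
    by (simp add: hnorm_def sum_nonneg ip_self_nonneg)
next
  case False
  let ?y = "frame_operator scale ip p f x"
  have "hnorm ip ?y * hnorm ip ?y = norm (ip ?y ?y)"
    by (simp add: ip_self power2_eq_square hnorm_nonneg norm_mult)
  also have "\<dots> \<le> (\<Sum>i=1..p. norm (ip x (f i) * ip (f i) ?y))"
    unfolding frame_operator_form[of p f x ?y] by (rule norm_sum)
  also have "\<dots> \<le> (\<Sum>i=1..p. (hnorm ip x * hnorm ip (f i)) * (hnorm ip (f i) * hnorm ip ?y))"
    unfolding norm_mult by (intro sum_mono mult_mono Cauchy_Schwarz) (simp_all add: hnorm_nonneg)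
  also have "\<dots> = (\<Sum>i=1..p. (hnorm ip (f i))\<^sup>2) * hnorm ip x * hnorm ip ?y"
    by (simp add: sum_distrib_left sum_distrib_right power2_eq_square mult_ac)
  finally show ?thesis using hnorm_pos[OF False] by simp
qed

lemma frame_operator_le_op_norm:
  "hnorm ip (frame_operator scale ip p f x) \<le> op_norm ip (frame_operator scale ip p f) * hnorm ip x"
proof (cases "x = 0")
  case True
  then show ?thesis by (simp add: frame_operator_def hnorm_def)
next
  case False
  let ?S = "frame_operator scale ip p f"
  let ?M = "\<Sum>i=1..p. (hnorm ip (f i))\<^sup>2"
  have bdd: "bdd_above ((\<lambda>x. hnorm ip (?S x)) ` {x. hnorm ip x \<le> 1})"
  proof (rule bdd_aboveI2)
    fix x assume "x \<in> {x. hnorm ip x \<le> 1}"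
    then have "?M * hnorm ip x \<le> ?M * 1" by (intro mult_left_mono) (auto simp: sum_nonneg)
    with frame_operator_bounded[of p f x] show "hnorm ip (?S x) \<le> ?M" by simp
  qed
  define h where "h = hnorm ip x"
  have h: "0 < h" using hnorm_pos[OF False] by (simp add: h_def)
  define y where "y = scale (of_real (1 / h)) x"
  have "hnorm ip y = 1" using h by (simp add: y_def hnorm_scale h_def[symmetric] norm_divide)
  then have "hnorm ip (?S y) \<le> op_norm ip ?S"
    unfolding op_norm_def by (intro cSUP_upper bdd) simp
  moreover have "hnorm ip (?S y) = hnorm ip (?S x) / h"
    using h by (simp add: y_def frame_operator_scale hnorm_scale norm_divide)
  ultimately show ?thesis using h by (simp add: h_def pos_divide_le_eq)
qed

lemma frame_sum_le_op_norm:
  "(\<Sum>i=1..p. (norm (ip x (f i)))\<^sup>2) \<le> op_norm ip (frame_operator scale ip p f) * rc_re (ip x x)"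
proof -
  let ?S = "frame_operator scale ip p f"
  have "ip x z * ip z x = of_real ((norm (ip x z))\<^sup>2)" for z
    unfolding ip_cnj[of z x] by (rule rc_mult_cnj_of_real)
  then have "(\<Sum>i=1..p. (norm (ip x (f i)))\<^sup>2) = rc_re (ip (?S x) x)"
    unfolding frame_operator_form by (simp add: rc_re_sum del: of_real_power)
  also have "\<dots> \<le> hnorm ip (?S x) * hnorm ip x"
    by (rule order_trans[OF rc_re_le_norm Cauchy_Schwarz])
  also have "\<dots> \<le> (op_norm ip ?S * hnorm ip x) * hnorm ip x"
    by (intro mult_right_mono frame_operator_le_op_norm hnorm_nonneg)
  finally show ?thesis by (simp add: power2_eq_square mult.assoc flip: hnorm_sq)
qed

lemma op_norm_frame_operator_nonneg:
  fixes x :: 'h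
  assumes "x \<noteq> 0"
  shows "0 \<le> op_norm ip (frame_operator scale ip p f)"
proof -
  have "0 \<le> op_norm ip (frame_operator scale ip p f) * hnorm ip x"
    by (rule order_trans[OF hnorm_nonneg frame_operator_le_op_norm])
  with hnorm_pos[of x] assms show ?thesis by (simp add: zero_le_mult_iff)
qed

end


section \<open>Coordinates\<close>

locale coordinates = inner_product_space scale ip
  for scale :: "'k::rc_field \<Rightarrow> 'h::ab_group_add \<Rightarrow> 'h" and ip :: "'h \<Rightarrow> 'h \<Rightarrow> 'k" +
  fixes n :: nat and e :: "nat \<Rightarrow> 'h"
  assumes basis: "orthonormal_basis scale ip n e"
begin

lemma ip_basis: "i \<in> {1..n} \<Longrightarrow> j \<in> {1..n} \<Longrightarrow> ip (e i) (e j) = (if i = j then 1 else 0)"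
  using basis unfolding orthonormal_basis_def by blast

definition vec :: "(nat \<Rightarrow> 'k) \<Rightarrow> 'h" where
  "vec y = (\<Sum>j=1..n. scale (y j) (e j))"

lemma ip_vec: "ip x (vec y) = (\<Sum>j=1..n. rc_cnj (y j) * ip x (e j))"
  by (simp add: vec_def ip_sum_right ip_scale_right)

lemma coord_vec:
  assumes "j \<in> {1..n}"
  shows "ip (vec y) (e j) = y j"
proof -
  have "ip (vec y) (e j) = (\<Sum>i=1..n. if i = j then y j else 0)"
    unfolding vec_def ip_sum_left ip_scale_left using assms
    by (intro sum.cong refl) (auto simp: ip_basis)
  then show ?thesis using assms by simp
qed

lemma vec_coords: "vec (\<lambda>j. ip x (e j)) = x"
proof -
  have "x \<in> span (e ` {1..n})" using basis by (simp add: orthonormal_basis_def)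
  then show ?thesis
  proof (induction rule: span_induct)
    case base
    show ?case
      by (auto simp: subspace_def vec_def ip_add_left ip_scale_left scale_left_distrib sum.distrib
          simp flip: scale_scale scale_sum_right)
  next
    case (step x)
    then obtain i where i: "i \<in> {1..n}" "x = e i" by auto
    have "vec (\<lambda>j. ip x (e j)) = (\<Sum>j=1..n. if j = i then e j else 0)"
      unfolding vec_def using i by (intro sum.cong refl) (auto simp: ip_basis)
    with i show ?case by simp
  qed
qed

lemma eq_coords: "(\<And>j. j \<in> {1..n} \<Longrightarrow> ip x (e j) = ip y (e j)) \<Longrightarrow> x = y"
  using vec_coords[of x] vec_coords[of y] by (simp add: vec_def)

lemma ip_vec_self: "rc_re (ip (vec y) (vec y)) = sq_norm n y"
proof -
  have "ip (vec y) (vec y) = of_real (sq_norm n y)"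
    unfolding of_real_sq_norm ip_vec[of "vec y"]
    by (intro sum.cong refl) (simp add: coord_vec mult.commute)
  then show ?thesis by simp
qed

end

text \<open>
  The matrix of \<open>C I - S\<close> in an orthonormal basis, where \<open>x i j\<close> are the coordinates of the
  vectors with frame operator \<open>S\<close>.
\<close>

definition defect_matrix ::
  "nat \<Rightarrow> (nat \<Rightarrow> nat \<Rightarrow> 'k::rc_field) \<Rightarrow> real \<Rightarrow> nat \<Rightarrow> nat \<Rightarrow> 'k" where
  "defect_matrix p x C l j = (if l = j then of_real C else 0) - (\<Sum>i=1..p. x i l * rc_cnj (x i j))"

definition coord_trace :: "nat \<Rightarrow> nat \<Rightarrow> (nat \<Rightarrow> nat \<Rightarrow> 'k::rc_field) \<Rightarrow> real" where
  "coord_trace n p x = (\<Sum>j=1..n. \<Sum>i=1..p. (norm (x i j))\<^sup>2)"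

lemma defect_matrix_trace:
  "(\<Sum>j=1..n. rc_re (defect_matrix p x C j j)) = C * real n - coord_trace n p x"
  by (simp add: defect_matrix_def coord_trace_def rc_re_diff rc_re_sum rc_mult_cnj_of_real
      sum_subtractf mult.commute del: of_real_power)

context coordinates
begin

abbreviation coord :: "(nat \<Rightarrow> 'h) \<Rightarrow> nat \<Rightarrow> nat \<Rightarrow> 'k" where
  "coord f i j \<equiv> ip (f i) (e j)"

lemma trace_frame_operator:
  "rc_re (op_trace ip n e (frame_operator scale ip p f)) = coord_trace n p (coord f)"
proof -
  have "ip x y * ip y x = of_real ((norm (ip y x))\<^sup>2)" for x y
    using ip_cnj[of x y] rc_mult_cnj_of_real[of "ip y x"] by (simp add: mult.commute)
  then show ?thesis
    by (simp add: op_trace_def frame_operator_form coord_trace_def rc_re_sum del: of_real_power)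
qed

text \<open>
  The form of the frame operator is the sum of the squared moduli of the inner products with the
  frame vectors, which is at most the operator norm times the squared length.
\<close>

lemma defect_matrix_bounded_below:
  assumes d: "op_norm ip (frame_operator scale ip p f) \<le> d" and C: "d + m \<le> C"
  shows "trailing_bounded_below n 0 m (defect_matrix p (coord f) C)"
proof -
  let ?A = "defect_matrix p (coord f) C"
  have "m * sq_norm n y \<le> qform n ?A y" for y
  proof -
    have *: "ip (vec y) (f i) = (\<Sum>l=1..n. y l * rc_cnj (coord f i l))" for i
      unfolding vec_def by (simp add: ip_sum_left ip_scale_left ip_cnj[of "f i"])
    have "(\<Sum>l=1..n. \<Sum>j=1..n. rc_cnj (y l) * ?A l j * y j)
        = (\<Sum>l=1..n. \<Sum>j=1..n. (if l = j then of_real C * (rc_cnj (y l) * y j) else 0))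
          - (\<Sum>l=1..n. \<Sum>j=1..n. \<Sum>i=1..p. rc_cnj (y l * rc_cnj (coord f i l)) * (y j * rc_cnj (coord f i j)))"
      unfolding sum_subtractf[symmetric] defect_matrix_def
      by (intro sum.cong refl)
        (simp add: algebra_simps rc_cnj_mult sum_distrib_left sum_distrib_right)
    also have "(\<Sum>l=1..n. \<Sum>j=1..n. (if l = j then of_real C * (rc_cnj (y l) * y j) else 0))
        = of_real C * (\<Sum>l=1..n. y l * rc_cnj (y l))"
      by (simp add: sum_distrib_left mult.commute)
    also have "(\<Sum>l=1..n. \<Sum>j=1..n. \<Sum>i=1..p. rc_cnj (y l * rc_cnj (coord f i l)) * (y j * rc_cnj (coord f i j)))
        = (\<Sum>i=1..p. \<Sum>l=1..n. \<Sum>j=1..n. rc_cnj (y l * rc_cnj (coord f i l)) * (y j * rc_cnj (coord f i j)))"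
      by (subst sum.swap[of _ "{1..p}" "{1..n}"], subst sum.swap[of _ "{1..p}" "{1..n}"]) (rule refl)
    also have "\<dots> = (\<Sum>i=1..p. rc_cnj (ip (vec y) (f i)) * ip (vec y) (f i))"
      unfolding * rc_cnj_sum sum_product ..
    finally have "qform n ?A y = C * sq_norm n y - (\<Sum>i=1..p. (norm (ip (vec y) (f i)))\<^sup>2)"
      unfolding qform_def rc_mult_cnj_of_real rc_cnj_mult_of_real
      by (simp add: rc_re_diff rc_re_sum sq_norm_def del: of_real_power)
    moreover have "(\<Sum>i=1..p. (norm (ip (vec y) (f i)))\<^sup>2) \<le> d * sq_norm n y"
      using frame_sum_le_op_norm[of "vec y" f p] mult_right_mono[OF d sq_norm_nonneg[of n y]]
      by (simp add: ip_vec_self)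
    moreover have "(d + m) * sq_norm n y \<le> C * sq_norm n y"
      by (rule mult_right_mono[OF C sq_norm_nonneg])
    ultimately show ?thesis by (simp add: algebra_simps)
  qed
  moreover have "?A j i = rc_cnj (?A i j)" for i j
    by (simp add: defect_matrix_def rc_cnj_diff rc_cnj_sum rc_cnj_mult mult.commute)
  moreover have "\<not> (i \<le> 0 \<or> j \<le> 0)" if "i \<in> {1..n}" "j \<in> {1..n}" for i j
    using that by simp
  ultimately show ?thesis unfolding trailing_bounded_below_def by blast
qed

text \<open>
  If the dyads of the new vectors sum to the defect matrix, the frame operators of the two
  sequences add up to \<open>C\<close> times the identity, coordinate by coordinate.
\<close>

lemma tight_frame_of_dyads:
  assumes C: "0 < C"
    and A: "\<And>l j. l \<in> {1..n} \<Longrightarrow> j \<in> {1..n} \<Longrightarrow>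
      defect_matrix p (coord f) C l j = (\<Sum>q=1..r. y q l * rc_cnj (y q j))"
  shows "tight_frame scale ip (p + r) (concat_seq p f (\<lambda>q. vec (y q)))"
  unfolding tight_frame_def
proof (intro exI[of _ C] conjI C allI)
  fix x
  let ?g = "\<lambda>q. vec (y q)"
  show "frame_operator scale ip (p + r) (concat_seq p f ?g) x = scale (of_real C) x"
  proof (rule eq_coords)
    fix l assume l: "l \<in> {1..n}"
    have cr: "ip x z = (\<Sum>j=1..n. rc_cnj (ip z (e j)) * ip x (e j))" for z
      using ip_vec[of x "\<lambda>j. ip z (e j)"] by (simp add: vec_coords)
    have "ip (frame_operator scale ip (p + r) (concat_seq p f ?g) x) (e l)
        = (\<Sum>i=1..p + r. ip x (concat_seq p f ?g i) * ip (concat_seq p f ?g i) (e l))"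
      by (rule frame_operator_form)
    also have "\<dots> = (\<Sum>i=1..p. ip x (f i) * ip (f i) (e l)) + (\<Sum>q=1..r. ip x (?g q) * y q l)"
    proof -
      have "{1..p + r} = {1..p} \<union> {p + 1..p + r}" by auto
      moreover have "(\<Sum>i=p + 1..p + r. ip x (concat_seq p f ?g i) * ip (concat_seq p f ?g i) (e l))
          = (\<Sum>q=1..r. ip x (?g q) * y q l)"
        by (rule sum.reindex_bij_witness[of _ "\<lambda>q. q + p" "\<lambda>i. i - p"])
          (use l in \<open>auto simp: concat_seq_def coord_vec\<close>)
      ultimately show ?thesis
        by (simp add: sum.union_disjoint concat_seq_def)
    qed
    also have "\<dots> = (\<Sum>j=1..n. ((\<Sum>i=1..p. coord f i l * rc_cnj (coord f i j))
          + (\<Sum>q=1..r. y q l * rc_cnj (y q j))) * ip x (e j))"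
    proof -
      have "(\<Sum>i=1..p. ip x (f i) * ip (f i) (e l))
          = (\<Sum>j=1..n. \<Sum>i=1..p. coord f i l * rc_cnj (coord f i j) * ip x (e j))"
        by (subst sum.swap, subst cr) (simp add: sum_distrib_left sum_distrib_right mult_ac)
      moreover have "(\<Sum>q=1..r. ip x (?g q) * y q l)
          = (\<Sum>j=1..n. \<Sum>q=1..r. y q l * rc_cnj (y q j) * ip x (e j))"
        by (subst sum.swap, subst ip_vec) (simp add: sum_distrib_left sum_distrib_right mult_ac)
      ultimately show ?thesis
        by (simp add: distrib_right sum_distrib_right sum.distrib)
    qed
    also have "\<dots> = (\<Sum>j=1..n. if l = j then of_real C * ip x (e l) else 0)"
    proof (intro sum.cong refl)
      fix j assume "j \<in> {1..n}"
      from A[OF l this]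
      have "(\<Sum>i=1..p. coord f i l * rc_cnj (coord f i j)) + (\<Sum>q=1..r. y q l * rc_cnj (y q j))
          = (if l = j then of_real C else 0)"
        unfolding defect_matrix_def by (simp add: diff_eq_eq)
      then show "((\<Sum>i=1..p. coord f i l * rc_cnj (coord f i j)) + (\<Sum>q=1..r. y q l * rc_cnj (y q j)))
          * ip x (e j) = (if l = j then of_real C * ip x (e l) else 0)"
        by simp
    qed
    also have "\<dots> = ip (scale (of_real C) x) (e l)"
      using l by (simp add: ip_scale_left)
    finally show "ip (frame_operator scale ip (p + r) (concat_seq p f ?g) x) (e l)
        = ip (scale (of_real C) x) (e l)" .
  qed
qed

end

section \<open>Loops over arrays\<close>

definition seti :: "string \<Rightarrow> nat \<Rightarrow> 'k state \<Rightarrow> 'k state" where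
  "seti x m s = ((fst s)(x := m), snd s)"

definition seta :: "string \<Rightarrow> (nat \<Rightarrow> nat \<Rightarrow> 'k) \<Rightarrow> 'k state \<Rightarrow> 'k state" where
  "seta A F s = (fst s, (snd s)(A := F))"

abbreviation setcell :: "string \<Rightarrow> nat \<Rightarrow> nat \<Rightarrow> 'k \<Rightarrow> 'k state \<Rightarrow> 'k state" where
  "setcell A i j z s \<equiv> seta A ((snd s A)(i := (snd s A i)(j := z))) s"

lemma seti_simps [simp]:
  "fst (seti x m s) = (fst s)(x := m)" "snd (seti x m s) = snd s"
  "seti x m (seti x m' s) = seti x m s" "fst s x = m \<Longrightarrow> seti x m s = s"
  by (auto simp: seti_def prod_eq_iff)

lemma seta_simps [simp]:
  "fst (seta A F s) = fst s" "snd (seta A F s) = (snd s)(A := F)"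
  "seta A F (seta A F' s) = seta A F s" "seta A (snd s A) s = s"
  by (auto simp: seta_def prod_eq_iff)

lemma seti_seta: "seti x m (seta A F s) = seta A F (seti x m s)"
  by (simp add: seti_def seta_def)

lemma exec_ISet: "ival a s = m \<Longrightarrow> exec (ISet x a) s (seti x m s)"
  unfolding seti_def using exec.ISet by blast

lemma exec_SSet:
  "sdefined a s \<Longrightarrow> ival i s = i' \<Longrightarrow> ival j s = j' \<Longrightarrow> sval a s = z \<Longrightarrow>
    exec (SSet A i j a) s (setcell A i' j' z s)"
  unfolding seta_def using exec.SSet by blast

text \<open>
  The counter runs from 1 to the value of \<open>N\<close> and is one larger when the loop ends.
\<close>

definition For :: "string \<Rightarrow> iexp \<Rightarrow> prog \<Rightarrow> prog" where
  "For x N P = Seq (ISet x (INum 1))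
     (While (TNot (ILess N (IVar x))) (Seq P (ISet x (IPlus (IVar x) (INum 1)))))"

text \<open>
  The invariant must not depend on the counter, whose value is provided separately.
\<close>

lemma exec_For_invariant:
  assumes init: "I 0 s"
    and step: "\<And>i t. i < m \<Longrightarrow> I i t \<Longrightarrow>
      \<exists>t'. exec P (seti x (Suc i) t) t' \<and> fst t' x = Suc i \<and> I (Suc i) t'"
    and counter: "\<And>i t c. I i t \<Longrightarrow> I i (seti x c t)"
    and bound: "\<And>i t. I i t \<Longrightarrow> ival N t = m"
  shows "\<exists>t. exec (For x N P) s t \<and> fst t x = Suc m \<and> I m t"
proof -
  let ?b = "TNot (ILess N (IVar x))" and ?Q = "Seq P (ISet x (IPlus (IVar x) (INum 1)))"
  have loop: "\<exists>t'. exec (While ?b ?Q) t t' \<and> fst t' x = Suc m \<and> I m t'"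
    if "i \<le> m" "I i t" "fst t x = Suc i" for i t
    using that
  proof (induction "m - i" arbitrary: i t)
    case 0
    then have "exec (While ?b ?Q) t t"
      by (intro exec.WhileFalse) (simp_all add: bound)
    with 0 show ?case by (intro exI[of _ t]) simp
  next
    case (Suc u)
    then have i: "i < m" by simp
    obtain t1 where t1: "exec P t t1" "fst t1 x = Suc i" "I (Suc i) t1"
      using step[OF i Suc.prems(2)] Suc.prems(3) by auto
    let ?t2 = "seti x (Suc (Suc i)) t1"
    have body: "exec ?Q t ?t2"
      using t1 by (intro exec.Seq[OF t1(1)] exec_ISet) simp
    obtain t' where t': "exec (While ?b ?Q) ?t2 t'" "fst t' x = Suc m" "I m t'"
    proof -
      have "u = m - Suc i" using Suc.hyps(2) by simp
      from Suc.hyps(1)[OF this, of ?t2] show ?thesis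
        using that i counter[OF t1(3)] by auto
    qed
    have "exec (While ?b ?Q) t t'"
      using i Suc.prems(3) bound[OF Suc.prems(2)]
      by (intro exec.WhileTrue[OF _ _ body t'(1)]) auto
    with t' show ?case by blast
  qed
  obtain t where t: "exec (While ?b ?Q) (seti x 1 s) t" "fst t x = Suc m" "I m t"
    using loop[of 0 "seti x 1 s"] counter[OF init] by auto
  have "exec (For x N P) s t"
    unfolding For_def by (rule exec.Seq[OF exec_ISet t(1)]) simp
  with t show ?thesis by blast
qed

text \<open>
  A version for loops with known intermediate states: \<open>S i\<close> is the state after \<open>i\<close> rounds, up to
  the value of the counter.
\<close>

lemma exec_For:
  assumes init: "S 0 = s"
    and step: "\<And>i. i < m \<Longrightarrow> exec P (seti x (Suc i) (S i)) (seti x (Suc i) (S (Suc i)))"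
    and bound: "\<And>i c. i \<le> m \<Longrightarrow> ival N (seti x c (S i)) = m"
  shows "exec (For x N P) s (seti x (Suc m) (S m))"
proof -
  have "\<exists>t. exec (For x N P) s t \<and> fst t x = Suc m \<and> (m \<le> m \<and> (\<exists>c. t = seti x c (S m)))"
  proof (rule exec_For_invariant[where I = "\<lambda>i t. i \<le> m \<and> (\<exists>c. t = seti x c (S i))"])
    show "0 \<le> m \<and> (\<exists>c. s = seti x c (S 0))"
      using init by (auto intro!: exI[of _ "fst s x"])
  next
    fix i t assume "i < m" "i \<le> m \<and> (\<exists>c. t = seti x c (S i))"
    then show "\<exists>t'. exec P (seti x (Suc i) t) t' \<and> fst t' x = Suc i \<and> Suc i \<le> m \<and> (\<exists>c. t' = seti x c (S (Suc i)))"
      using step[of i] by (intro exI[of _ "seti x (Suc i) (S (Suc i))"]) auto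
  qed (auto simp: bound)
  then obtain t c where "exec (For x N P) s t" "fst t x = Suc m" "t = seti x c (S m)" by blast
  moreover then have "c = Suc m" by simp
  ultimately show ?thesis by simp
qed

definition SumLoop :: "string \<Rightarrow> iexp \<Rightarrow> string \<Rightarrow> sexp \<Rightarrow> prog" where
  "SumLoop x N A e = Seq (SSet A (INum 0) (INum 0) SZero)
     (For x N (SSet A (INum 0) (INum 0) (SPlus (SElem A (INum 0) (INum 0)) e)))"

text \<open>
  The summand may be evaluated for every content \<open>z\<close> of the accumulator, that is, it must not
  read it.
\<close>

lemma exec_SumLoop:
  assumes e: "\<And>j z. j \<in> {1..m} \<Longrightarrow> sdefined e (setcell A 0 0 z (seti x j s))"
      "\<And>j z. j \<in> {1..m} \<Longrightarrow> sval e (setcell A 0 0 z (seti x j s)) = v j"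
    and N: "\<And>c z. ival N (setcell A 0 0 z (seti x c s)) = m"
  shows "exec (SumLoop x N A e) s (setcell A 0 0 (\<Sum>j=1..m. v j) (seti x (Suc m) s))"
proof -
  let ?S = "\<lambda>i. setcell A 0 0 (\<Sum>j=1..i. v j) s"
  have "exec (For x N (SSet A (INum 0) (INum 0) (SPlus (SElem A (INum 0) (INum 0)) e)))
      (?S 0) (seti x (Suc m) (?S m))"
  proof (rule exec_For[where S = ?S])
    fix i assume i: "i < m"
    let ?t = "seti x (Suc i) (?S i)"
    have "exec (SSet A (INum 0) (INum 0) (SPlus (SElem A (INum 0) (INum 0)) e)) ?t
        (setcell A 0 0 (\<Sum>j=1..Suc i. v j) ?t)"
      using e[of "Suc i" "\<Sum>j=1..i. v j"] i by (intro exec_SSet) (auto simp: seti_seta)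
    then show "exec (SSet A (INum 0) (INum 0) (SPlus (SElem A (INum 0) (INum 0)) e)) ?t
        (seti x (Suc i) (?S (Suc i)))"
      by (simp add: seti_seta)
  next
    fix i c
    show "ival N (seti x c (?S i)) = m" using N[where z = "\<Sum>j=1..i. v j" and c = c] by (simp add: seti_seta)
  qed simp
  moreover have "exec (SSet A (INum 0) (INum 0) SZero) s (?S 0)"
    by (rule exec_SSet) simp_all
  ultimately show ?thesis
    unfolding SumLoop_def by (auto intro: exec.Seq simp: seti_seta)
qed

definition RowLoop :: "string \<Rightarrow> iexp \<Rightarrow> string \<Rightarrow> iexp \<Rightarrow> sexp \<Rightarrow> prog" where
  "RowLoop x N A i e = For x N (SSet A i (IVar x) e)"

text \<open>
  In round \<open>j\<close> the cell \<open>j\<close> of the row still has its old value, so \<open>e\<close> may read it; the other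
  cells of the row, here an arbitrary \<open>R\<close>, may already have been overwritten.
\<close>

lemma exec_RowLoop:
  assumes e: "\<And>j R. j \<in> {1..m} \<Longrightarrow> R j = snd s A i' j \<Longrightarrow>
        sdefined e (seta A ((snd s A)(i' := R)) (seti x j s))"
      "\<And>j R. j \<in> {1..m} \<Longrightarrow> R j = snd s A i' j \<Longrightarrow>
        sval e (seta A ((snd s A)(i' := R)) (seti x j s)) = v j"
    and i: "\<And>j R. ival i (seta A ((snd s A)(i' := R)) (seti x j s)) = i'"
    and N: "\<And>j R. ival N (seta A ((snd s A)(i' := R)) (seti x j s)) = m"
  shows "exec (RowLoop x N A i e) s
    (seta A ((snd s A)(i' := (\<lambda>j. if j \<in> {1..m} then v j else snd s A i' j))) (seti x (Suc m) s))"
proof -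
  let ?R = "\<lambda>k j. if j \<in> {1..k} then v j else snd s A i' j"
  let ?S = "\<lambda>k. seta A ((snd s A)(i' := ?R k)) s"
  have "exec (RowLoop x N A i e) s (seti x (Suc m) (?S m))"
    unfolding RowLoop_def
  proof (rule exec_For[where S = ?S])
    fix k assume k: "k < m"
    let ?t = "seti x (Suc k) (?S k)"
    have "exec (SSet A i (IVar x) e) ?t (setcell A i' (Suc k) (v (Suc k)) ?t)"
      unfolding seti_seta using k by (intro exec_SSet e i) auto
    moreover have "(?R k)(Suc k := v (Suc k)) = ?R (Suc k)"
      by (auto simp: fun_eq_iff)
    ultimately show "exec (SSet A i (IVar x) e) ?t (seti x (Suc k) (?S (Suc k)))"
      by (simp add: seti_seta)
  next
    fix k c
    show "ival N (seti x c (?S k)) = m" unfolding seti_seta by (rule N)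
  qed simp
  then show ?thesis by (simp add: seti_seta)
qed

definition MatrixLoop :: "string \<Rightarrow> string \<Rightarrow> iexp \<Rightarrow> string \<Rightarrow> sexp \<Rightarrow> prog" where
  "MatrixLoop y x N A e = For y N (RowLoop x N A (IVar y) e)"

text \<open>
  As for rows, \<open>e\<close> may read the cell that it overwrites and no other cell of the same array.
\<close>

lemma exec_MatrixLoop:
  assumes xy: "x \<noteq> y" and m: "1 \<le> m"
    and e: "\<And>l j M. l \<in> {1..m} \<Longrightarrow> j \<in> {1..m} \<Longrightarrow> M l j = snd s A l j \<Longrightarrow>
        sdefined e (seta A M (seti x j (seti y l s)))"
      "\<And>l j M. l \<in> {1..m} \<Longrightarrow> j \<in> {1..m} \<Longrightarrow> M l j = snd s A l j \<Longrightarrow>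
        sval e (seta A M (seti x j (seti y l s))) = v l j"
    and N: "\<And>l j M. ival N (seta A M (seti x j (seti y l s))) = m"
  shows "exec (MatrixLoop y x N A e) s
    (seta A (\<lambda>l j. if l \<in> {1..m} \<and> j \<in> {1..m} then v l j else snd s A l j)
      (seti x (Suc m) (seti y (Suc m) s)))"
proof -
  let ?M = "\<lambda>k l j. if l \<in> {1..k} \<and> j \<in> {1..m} then v l j else snd s A l j"
  \<comment> \<open>The inner counter is untouched until the first row has been processed.\<close>
  define X where "X k = (if k = 0 then s else seti x (Suc m) s)" for k :: nat
  have X: "seti x j (seti y l (X k)) = seti x j (seti y l s)" "snd (X k) = snd s" for k l j
    using xy by (auto simp: X_def seti_def fun_eq_iff)
  have Xs: "seti y l (X k) = seti x (if k = 0 then fst s x else Suc m) (seti y l s)" for k l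
    using xy by (auto simp: X_def seti_def fun_eq_iff prod_eq_iff)
  let ?S = "\<lambda>k. seta A (?M k) (X k)"
  have "exec (MatrixLoop y x N A e) s (seti y (Suc m) (?S m))"
    unfolding MatrixLoop_def
  proof (rule exec_For[where S = ?S])
    show "?S 0 = s" by (simp add: X_def)
  next
    fix k assume k: "k < m"
    let ?t = "seti y (Suc k) (?S k)"
    have 1: "seta A ((snd ?t A)(Suc k := R)) (seti x j ?t)
        = seta A ((?M k)(Suc k := R)) (seti x j (seti y (Suc k) s))" for j R
      by (simp add: seti_seta X)
    have "exec (RowLoop x N A (IVar y) e) ?t
        (seta A ((snd ?t A)(Suc k := (\<lambda>j. if j \<in> {1..m} then v (Suc k) j else snd ?t A (Suc k) j))) (seti x (Suc m) ?t))"
    proof (rule exec_RowLoop[where v = "v (Suc k)"])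
      fix j R assume "j \<in> {1..m}" "R j = snd ?t A (Suc k) j"
      with k show "sdefined e (seta A ((snd ?t A)(Suc k := R)) (seti x j ?t))"
        "sval e (seta A ((snd ?t A)(Suc k := R)) (seti x j ?t)) = v (Suc k) j"
        unfolding 1 by (auto intro!: e simp: X)
    next
      fix j R
      show "ival (IVar y) (seta A ((snd ?t A)(Suc k := R)) (seti x j ?t)) = Suc k"
        using xy by simp
      show "ival N (seta A ((snd ?t A)(Suc k := R)) (seti x j ?t)) = m"
        unfolding 1 by (rule N)
    qed
    moreover have "(snd ?t A)(Suc k := (\<lambda>j. if j \<in> {1..m} then v (Suc k) j else snd ?t A (Suc k) j)) = ?M (Suc k)"
      by (auto simp: fun_eq_iff)
    ultimately show "exec (RowLoop x N A (IVar y) e) ?t (seti y (Suc k) (?S (Suc k)))"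
      by (simp add: seti_seta X Xs)
  next
    fix k c
    show "ival N (seti y c (?S k)) = m"
      unfolding seti_seta Xs by (rule N)
  qed
  then show ?thesis using m by (simp add: seti_seta Xs)
qed

section \<open>The algorithm\<close>

abbreviation scalar :: "string \<Rightarrow> sexp" where "scalar A \<equiv> SElem A (INum 0) (INum 0)"
abbreviation entry :: "string \<Rightarrow> string \<Rightarrow> sexp" where "entry A x \<equiv> SElem A (INum 0) (IVar x)"
abbreviation entry2 :: "string \<Rightarrow> string \<Rightarrow> string \<Rightarrow> sexp" where "entry2 A x y \<equiv> SElem A (IVar x) (IVar y)"
abbreviation target :: sexp where "target \<equiv> SElem ''a'' (IVar ''i'') (INum 0)"
abbreviation SetScalar :: "string \<Rightarrow> sexp \<Rightarrow> prog" where "SetScalar A e \<equiv> SSet A (INum 0) (INum 0) e"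

text \<open>
  The program variables: \<open>v\<close>, \<open>w\<close>, \<open>B\<close>, \<open>g\<close>, \<open>k\<close> are the components of a partial
  decomposition (\<open>v\<close> and \<open>w\<close> in row 0 of their arrays), \<open>i\<close> is the number of the vector to be
  found, \<open>a\<close> contains the prescribed squared lengths, and \<open>m\<close> is the squared length of \<open>v\<close>.
  The first half of a step provides a short vector \<open>v\<close> and a long vector \<open>w\<close>.
\<close>

definition Select :: prog where
  "Select =
     Seq (SumLoop ''j'' (IVar ''n'') ''m'' (STimes (entry ''v'' ''j'') (SCnj (entry ''v'' ''j''))))
    (Cond (SLess (scalar ''m'') target)
       (Seq (ISet ''k'' (IPlus (IVar ''k'') (INum 1)))
       (Seq (RowLoop ''j'' (IVar ''n'') ''w'' (INum 0)
               (SDivide (entry2 ''B'' ''j'' ''k'') (SSqrt (entry2 ''B'' ''k'' ''k''))))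
            (MatrixLoop ''l'' ''j'' (IVar ''n'') ''B''
               (SMinus (entry2 ''B'' ''l'' ''j'') (STimes (entry ''w'' ''l'') (SCnj (entry ''w'' ''j'')))))))
       (Seq (RowLoop ''j'' (IVar ''n'') ''w'' (INum 0) (entry ''v'' ''j''))
       (Seq (RowLoop ''j'' (IVar ''n'') ''v'' (INum 0) SZero)
            (SetScalar ''m'' SZero))))"

text \<open>
  The part of the state that the main loop only reads.
\<close>

definition holds_data :: "nat \<Rightarrow> nat \<Rightarrow> (nat \<Rightarrow> real) \<Rightarrow> 'k::rc_field state \<Rightarrow> bool" where
  "holds_data n r a t \<longleftrightarrow> fst t ''n'' = n \<and> fst t ''r'' = r \<and> (\<forall>i\<ge>1. snd t ''a'' i 0 = of_real (a i))"

lemma exec_Select: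
  fixes s :: "'k::rc_field state"
  assumes n: "1 \<le> n" and data: "holds_data n r a s" and i: "fst s ''i'' = i" "i \<in> {1..r}"
    and P: "partial_decomposition n a A i (fst s ''k'') (snd s ''v'' 0) (\<lambda>_. 0) (snd s ''B'') (snd s ''g'')"
    and tr: "(\<Sum>j=1..n. rc_re (A j j)) = (\<Sum>q=1..r. a q)"
    and pos: "\<And>q. 1 \<le> q \<Longrightarrow> 0 < a q" and le: "a i \<le> a 1"
  shows "\<exists>t. exec Select s t \<and> holds_data n r a t \<and> fst t ''i'' = i \<and>
    snd t ''m'' 0 0 = of_real (sq_norm n (snd t ''v'' 0)) \<and>
    sq_norm n (snd t ''v'' 0) < a i \<and> a i \<le> sq_norm n (snd t ''w'' 0) \<and>
    partial_decomposition n a A i (fst t ''k'') (snd t ''v'' 0) (snd t ''w'' 0) (snd t ''B'') (snd t ''g'')"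
proof -
  define v where "v = snd s ''v'' 0"
  define B where "B = snd s ''B''"
  define K where "K = Suc (fst s ''k'')"
  have sn: "fst s ''n'' = n" and sr: "fst s ''r'' = r"
    and sa: "\<And>q. 1 \<le> q \<Longrightarrow> snd s ''a'' q 0 = of_real (a q)"
    using data by (auto simp: holds_data_def)
  define s1 where "s1 = setcell ''m'' 0 0 (of_real (sq_norm n v)) (seti ''j'' (Suc n) s)"
  have e1: "exec (SumLoop ''j'' (IVar ''n'') ''m'' (STimes (entry ''v'' ''j'') (SCnj (entry ''v'' ''j'')))) s s1"
    unfolding s1_def of_real_sq_norm
    by (rule exec_SumLoop) (simp_all add: v_def sn)
  let ?test = "SLess (scalar ''m'') target"
  have test: "tdefined ?test s1" "tval ?test s1 \<longleftrightarrow> sq_norm n v < a i"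
    using i by (simp_all add: s1_def sa)
  show ?thesis
  proof (cases "sq_norm n v < a i")
    case True
    note peel = partial_decomposition_peel[OF P tr pos i(2) True[unfolded v_def]]
    have K: "K \<in> {1..n}" using peel(1) by (simp add: K_def)
    have trail: "trailing_bounded_below n (fst s ''k'') (a 1) B"
      using P by (simp add: partial_decomposition_def B_def)
    have BK: "B K K = of_real (rc_re (B K K))" "a 1 \<le> rc_re (B K K)"
      using trailing_diag[OF trail, of K] K by (auto simp: K_def)
    have BK0: "0 < rc_re (B K K)" using BK(2) pos[of 1] by simp
    define w where "w j = (if j \<in> {1..n} then B j K / of_real (sqrt (rc_re (B K K))) else snd s ''w'' 0 j)" for j
    define B' where "B' l j = (if l \<in> {1..n} \<and> j \<in> {1..n} then B l j - w l * rc_cnj (w j) else B l j)" for l j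
    define s2 where "s2 = seti ''k'' K s1"
    define s3 where "s3 = seta ''w'' ((snd s2 ''w'')(0 := w)) (seti ''j'' (Suc n) s2)"
    define s4 where "s4 = seta ''B'' B' (seti ''j'' (Suc n) (seti ''l'' (Suc n) s3))"
    have e2: "exec (ISet ''k'' (IPlus (IVar ''k'') (INum 1))) s1 s2"
      unfolding s2_def by (rule exec_ISet) (simp add: s1_def K_def)
    have BKR: "B K K \<in> \<real>" by (subst BK(1)) simp
    have e3: "exec (RowLoop ''j'' (IVar ''n'') ''w'' (INum 0)
               (SDivide (entry2 ''B'' ''j'' ''k'') (SSqrt (entry2 ''B'' ''k'' ''k'')))) s2 s3"
    proof -
      have w: "w = (\<lambda>j. if j \<in> {1..n} then B j K / of_real (sqrt (rc_re (B K K))) else snd s2 ''w'' 0 j)"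
        by (simp add: w_def fun_eq_iff s2_def s1_def)
      show ?thesis
        unfolding s3_def w
        by (rule exec_RowLoop) (use BK0 BKR in \<open>simp_all add: s2_def s1_def sn B_def\<close>)
    qed
    have e4: "exec (MatrixLoop ''l'' ''j'' (IVar ''n'') ''B''
               (SMinus (entry2 ''B'' ''l'' ''j'') (STimes (entry ''w'' ''l'') (SCnj (entry ''w'' ''j''))))) s3 s4"
    proof -
      have B': "B' = (\<lambda>l j. if l \<in> {1..n} \<and> j \<in> {1..n} then B l j - w l * rc_cnj (w j) else snd s3 ''B'' l j)"
        by (simp add: B'_def fun_eq_iff s3_def s2_def s1_def B_def)
      show ?thesis
        unfolding s4_def B'
        by (rule exec_MatrixLoop) (use n in \<open>simp_all add: s3_def s2_def s1_def sn B_def\<close>)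
    qed
    have proj: "snd s4 ''w'' 0 = w" "snd s4 ''v'' 0 = v" "snd s4 ''B'' = B'" "snd s4 ''g'' = snd s ''g''"
      "snd s4 ''m'' 0 0 = of_real (sq_norm n v)" "snd s4 ''a'' = snd s ''a''" "fst s4 ''k'' = K"
      "fst s4 ''i'' = i" "fst s4 ''n'' = n" "fst s4 ''r'' = r"
      using i by (simp_all add: s4_def s3_def s2_def s1_def v_def sn sr)
    have "partial_decomposition n a A i K v w B' (snd s ''g'') \<and> a 1 \<le> sq_norm n w"
      using peel(2)[of w B'] unfolding K_def[symmetric] B_def[symmetric] v_def[symmetric]
      by (simp add: w_def B'_def)
    moreover have "exec Select s s4"
      unfolding Select_def using True
      by (intro exec.Seq[OF e1] exec.CondTrue[OF test(1)] test(2)[THEN iffD2] exec.Seq[OF e2] exec.Seq[OF e3] e4)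
    ultimately show ?thesis
      using True le data by (intro exI[of _ s4]) (simp add: proj holds_data_def)
  next
    case False
    define w where "w j = (if j \<in> {1..n} then v j else snd s ''w'' 0 j)" for j
    define u where "u j = (if j \<in> {1..n} then 0 else v j)" for j
    define s2 where "s2 = seta ''w'' ((snd s1 ''w'')(0 := w)) (seti ''j'' (Suc n) s1)"
    define s3 where "s3 = seta ''v'' ((snd s2 ''v'')(0 := u)) (seti ''j'' (Suc n) s2)"
    define s4 where "s4 = setcell ''m'' 0 0 0 s3"
    have e2: "exec (RowLoop ''j'' (IVar ''n'') ''w'' (INum 0) (entry ''v'' ''j'')) s1 s2"
    proof -
      have w: "w = (\<lambda>j. if j \<in> {1..n} then v j else snd s1 ''w'' 0 j)"
        by (simp add: w_def fun_eq_iff s1_def)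
      show ?thesis
        unfolding s2_def w
        by (rule exec_RowLoop) (simp_all add: s1_def sn v_def)
    qed
    have e3: "exec (RowLoop ''j'' (IVar ''n'') ''v'' (INum 0) SZero) s2 s3"
    proof -
      have u: "u = (\<lambda>j. if j \<in> {1..n} then 0 else snd s2 ''v'' 0 j)"
        by (simp add: u_def fun_eq_iff s1_def s2_def v_def)
      show ?thesis
        unfolding s3_def u
        by (rule exec_RowLoop) (simp_all add: s1_def s2_def sn v_def)
    qed
    have e4: "exec (SetScalar ''m'' SZero) s3 s4"
      unfolding s4_def by (rule exec_SSet) simp_all
    have proj: "snd s4 ''w'' 0 = w" "snd s4 ''v'' 0 = u" "snd s4 ''B'' = B" "snd s4 ''g'' = snd s ''g''"
      "snd s4 ''m'' 0 0 = 0" "snd s4 ''a'' = snd s ''a''" "fst s4 ''k'' = fst s ''k''"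
      "fst s4 ''i'' = i" "fst s4 ''n'' = n" "fst s4 ''r'' = r"
      using i by (simp_all add: s4_def s3_def s2_def s1_def v_def B_def sn sr)
    have u0: "sq_norm n u = 0" by (simp add: sq_norm_eq_0 u_def)
    have "sq_norm n w = sq_norm n v" by (simp add: sq_norm_def w_def)
    moreover have "partial_decomposition n a A i (fst s ''k'') u w B (snd s ''g'')"
      using P unfolding B_def by (rule partial_decomposition_swap) (simp_all add: w_def u_def v_def)
    moreover have "exec Select s s4"
      unfolding Select_def using False unfolding test(2)[symmetric]
      by (intro exec.Seq[OF e1] exec.CondFalse[OF test(1)] exec.Seq[OF e2] exec.Seq[OF e3] e4)
    ultimately show ?thesis
      using False le data pos[of i] i by (intro exI[of _ s4]) (simp add: proj holds_data_def u0)
  qed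
qed

text \<open>
  The second half of a step. Here \<open>M\<close> is the squared length of \<open>w\<close>, \<open>z\<close> is twice the real part
  \<open>h\<close> of the inner product of \<open>v\<close> and \<open>w\<close>, which is obtained by adding conjugates, \<open>s\<close> is the
  slope and \<open>N\<close> the normalizing factor of the rotation. The row of \<open>g\<close> is written first because
  it needs the old \<open>v\<close>.
\<close>

definition Rotate :: prog where
  "Rotate =
     Seq (SumLoop ''j'' (IVar ''n'') ''M'' (STimes (entry ''w'' ''j'') (SCnj (entry ''w'' ''j''))))
    (Seq (SumLoop ''j'' (IVar ''n'') ''z''
            (SPlus (STimes (entry ''v'' ''j'') (SCnj (entry ''w'' ''j'')))
                   (SCnj (STimes (entry ''v'' ''j'') (SCnj (entry ''w'' ''j''))))))
    (Seq (SetScalar ''h'' (SDivide (scalar ''z'') (SPlus SOne SOne)))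
    (Seq (SetScalar ''s''
            (SDivide (SPlus (scalar ''h'')
                        (SSqrt (SPlus (STimes (scalar ''h'') (scalar ''h''))
                           (STimes (SMinus (scalar ''M'') target) (SMinus target (scalar ''m''))))))
                     (SMinus target (scalar ''m''))))
    (Seq (SetScalar ''N'' (SSqrt (SPlus SOne (STimes (scalar ''s'') (scalar ''s'')))))
    (Seq (RowLoop ''j'' (IVar ''n'') ''g'' (IVar ''i'')
            (SDivide (SPlus (STimes (scalar ''s'') (entry ''v'' ''j'')) (entry ''w'' ''j'')) (scalar ''N'')))
         (RowLoop ''j'' (IVar ''n'') ''v'' (INum 0)
            (SDivide (SMinus (entry ''v'' ''j'') (STimes (scalar ''s'') (entry ''w'' ''j''))) (scalar ''N''))))))))"

lemma exec_Rotate: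
  fixes s :: "'k::rc_field state"
  assumes data: "holds_data n r a s" and i: "fst s ''i'' = i" "1 \<le> i"
    and m: "snd s ''m'' 0 0 = of_real (sq_norm n (snd s ''v'' 0))"
    and small: "sq_norm n (snd s ''v'' 0) < a i" and large: "a i \<le> sq_norm n (snd s ''w'' 0)"
    and P: "partial_decomposition n a A i (fst s ''k'') (snd s ''v'' 0) (snd s ''w'' 0) (snd s ''B'') (snd s ''g'')"
  shows "\<exists>t. exec Rotate s t \<and> holds_data n r a t \<and> fst t ''i'' = i \<and>
    partial_decomposition n a A (Suc i) (fst t ''k'') (snd t ''v'' 0) (\<lambda>_. 0) (snd t ''B'') (snd t ''g'')"
proof -
  define v where "v = snd s ''v'' 0"
  define w where "w = snd s ''w'' 0"
  define h where "h = rc_re (\<Sum>j=1..n. v j * rc_cnj (w j))"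
  define \<sigma> where "\<sigma> = rot_slope (a i) (sq_norm n v) (sq_norm n w) h"
  have sn: "fst s ''n'' = n" and sr: "fst s ''r'' = r"
    and sa: "snd s ''a'' i 0 = of_real (a i)"
    using data i by (auto simp: holds_data_def)
  define s1 where "s1 = setcell ''M'' 0 0 (of_real (sq_norm n w)) (seti ''j'' (Suc n) s)"
  define s2 where "s2 = setcell ''z'' 0 0 (of_real (2 * h)) (seti ''j'' (Suc n) s1)"
  define s3 where "s3 = setcell ''h'' 0 0 (of_real h) s2"
  define s4 where "s4 = setcell ''s'' 0 0 (of_real \<sigma>) s3"
  define s5 where "s5 = setcell ''N'' 0 0 (of_real (sqrt (1 + \<sigma>\<^sup>2))) s4"
  define gi where "gi j = (if j \<in> {1..n} then (of_real \<sigma> * v j + w j) / of_real (sqrt (1 + \<sigma>\<^sup>2)) else snd s ''g'' i j)" for j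
  define s6 where "s6 = seta ''g'' ((snd s ''g'')(i := gi)) (seti ''j'' (Suc n) s5)"
  define v' where "v' j = (if j \<in> {1..n} then (v j - of_real \<sigma> * w j) / of_real (sqrt (1 + \<sigma>\<^sup>2)) else v j)" for j
  define s7 where "s7 = seta ''v'' ((snd s ''v'')(0 := v')) (seti ''j'' (Suc n) s6)"
  have N0: "0 < 1 + \<sigma>\<^sup>2" by (simp add: add_pos_nonneg)
  have e1: "exec (SumLoop ''j'' (IVar ''n'') ''M'' (STimes (entry ''w'' ''j'') (SCnj (entry ''w'' ''j'')))) s s1"
    unfolding s1_def of_real_sq_norm by (rule exec_SumLoop) (simp_all add: w_def sn)
  have e2: "exec (SumLoop ''j'' (IVar ''n'') ''z''
            (SPlus (STimes (entry ''v'' ''j'') (SCnj (entry ''w'' ''j'')))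
                   (SCnj (STimes (entry ''v'' ''j'') (SCnj (entry ''w'' ''j'')))))) s1 s2"
  proof -
    have z: "of_real (2 * h) = (\<Sum>j=1..n. v j * rc_cnj (w j) + rc_cnj (v j * rc_cnj (w j)))"
      unfolding h_def rc_add_cnj_of_real rc_re_sum by (simp add: sum_distrib_left)
    show ?thesis
      unfolding s2_def z by (rule exec_SumLoop) (simp_all add: s1_def v_def w_def sn)
  qed
  have e3: "exec (SetScalar ''h'' (SDivide (scalar ''z'') (SPlus SOne SOne))) s2 s3"
    unfolding s3_def by (rule exec_SSet) (simp_all add: s2_def)
  have e4: "exec (SetScalar ''s''
            (SDivide (SPlus (scalar ''h'')
                        (SSqrt (SPlus (STimes (scalar ''h'') (scalar ''h''))
                           (STimes (SMinus (scalar ''M'') target) (SMinus target (scalar ''m''))))))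
                     (SMinus target (scalar ''m'')))) s3 s4"
  proof -
    have D: "snd s3 ''h'' 0 0 * snd s3 ''h'' 0 0
        + (snd s3 ''M'' 0 0 - snd s3 ''a'' (fst s3 ''i'') 0) * (snd s3 ''a'' (fst s3 ''i'') 0 - snd s3 ''m'' 0 0)
      = of_real (h\<^sup>2 + (sq_norm n w - a i) * (a i - sq_norm n v))"
      by (simp add: s3_def s2_def s1_def sa i m v_def power2_eq_square)
    have am: "snd s3 ''a'' (fst s3 ''i'') 0 - snd s3 ''m'' 0 0 = of_real (a i - sq_norm n v)"
      by (simp add: s3_def s2_def s1_def sa i m v_def)
    have h3: "snd s3 ''h'' 0 0 = of_real h" by (simp add: s3_def)
    have pos: "0 \<le> h\<^sup>2 + (sq_norm n w - a i) * (a i - sq_norm n v)"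
      using small large by (simp add: v_def w_def)
    have nz: "a i - sq_norm n v \<noteq> 0" using small by (simp add: v_def)
    show ?thesis
      unfolding s4_def
    proof (rule exec_SSet)
      show "sdefined (SDivide (SPlus (scalar ''h'')
                        (SSqrt (SPlus (STimes (scalar ''h'') (scalar ''h''))
                           (STimes (SMinus (scalar ''M'') target) (SMinus target (scalar ''m''))))))
                     (SMinus target (scalar ''m''))) s3"
        unfolding sdefined.simps sval.simps ival.simps unfolding D unfolding am
        using pos nz by (simp del: of_real_add of_real_diff of_real_mult of_real_power)
      show "sval (SDivide (SPlus (scalar ''h'')
                        (SSqrt (SPlus (STimes (scalar ''h'') (scalar ''h''))
                           (STimes (SMinus (scalar ''M'') target) (SMinus target (scalar ''m''))))))
                     (SMinus target (scalar ''m''))) s3 = of_real \<sigma>"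
        unfolding sval.simps ival.simps unfolding D unfolding am h3 rc_re_of_real \<sigma>_def rot_slope_def
        by simp
    qed simp_all
  qed
  have e5: "exec (SetScalar ''N'' (SSqrt (SPlus SOne (STimes (scalar ''s'') (scalar ''s''))))) s4 s5"
  proof -
    have D: "1 + snd s4 ''s'' 0 0 * snd s4 ''s'' 0 0 = of_real (1 + \<sigma>\<^sup>2)"
      by (simp add: s4_def power2_eq_square)
    show ?thesis
      unfolding s5_def
    proof (rule exec_SSet)
      show "sdefined (SSqrt (SPlus SOne (STimes (scalar ''s'') (scalar ''s'')))) s4"
        "sval (SSqrt (SPlus SOne (STimes (scalar ''s'') (scalar ''s'')))) s4 = of_real (sqrt (1 + \<sigma>\<^sup>2))"
        unfolding sdefined.simps sval.simps ival.simps D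
        using N0 by (simp_all del: of_real_add of_real_power)
    qed simp_all
  qed
  have sqrtN: "sqrt (1 + \<sigma>\<^sup>2) \<noteq> 0" using N0 by simp
  have e6: "exec (RowLoop ''j'' (IVar ''n'') ''g'' (IVar ''i'')
            (SDivide (SPlus (STimes (scalar ''s'') (entry ''v'' ''j'')) (entry ''w'' ''j'')) (scalar ''N''))) s5 s6"
  proof -
    have g: "(snd s ''g'')(i := gi) = (snd s5 ''g'')(i := (\<lambda>j. if j \<in> {1..n}
        then (of_real \<sigma> * v j + w j) / of_real (sqrt (1 + \<sigma>\<^sup>2)) else snd s5 ''g'' i j))"
      by (simp add: gi_def fun_eq_iff s5_def s4_def s3_def s2_def s1_def)
    show ?thesis
      unfolding s6_def g
      by (rule exec_RowLoop)
        (use sqrtN in \<open>simp_all add: s5_def s4_def s3_def s2_def s1_def v_def w_def i sn\<close>)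
  qed
  have e7: "exec (RowLoop ''j'' (IVar ''n'') ''v'' (INum 0)
            (SDivide (SMinus (entry ''v'' ''j'') (STimes (scalar ''s'') (entry ''w'' ''j''))) (scalar ''N''))) s6 s7"
  proof -
    have v': "(snd s ''v'')(0 := v') = (snd s6 ''v'')(0 := (\<lambda>j. if j \<in> {1..n}
        then (v j - of_real \<sigma> * w j) / of_real (sqrt (1 + \<sigma>\<^sup>2)) else snd s6 ''v'' 0 j))"
      by (simp add: v'_def v_def fun_eq_iff s6_def s5_def s4_def s3_def s2_def s1_def)
    show ?thesis
      unfolding s7_def v'
      by (rule exec_RowLoop)
        (use sqrtN in \<open>simp_all add: s6_def s5_def s4_def s3_def s2_def s1_def v_def w_def i sn\<close>)
  qed
  have proj: "snd s7 ''v'' 0 = v'" "snd s7 ''B'' = snd s ''B''" "snd s7 ''g'' = (snd s ''g'')(i := gi)"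
    "snd s7 ''a'' = snd s ''a''" "fst s7 ''k'' = fst s ''k''" "fst s7 ''i'' = i" "fst s7 ''n'' = n" "fst s7 ''r'' = r"
    by (simp_all add: s7_def s6_def s5_def s4_def s3_def s2_def s1_def i sn sr)
  have "partial_decomposition n a A (Suc i) (fst s ''k'') v' (\<lambda>_. 0) (snd s ''B'') ((snd s ''g'')(i := gi))"
    by (rule partial_decomposition_rotate[OF P i(2) small large \<sigma>_def[unfolded h_def v_def w_def]])
      (simp_all add: gi_def v'_def v_def w_def)
  moreover have "exec Rotate s s7"
    unfolding Rotate_def by (intro exec.Seq[OF e1] exec.Seq[OF e2] exec.Seq[OF e3] exec.Seq[OF e4]
        exec.Seq[OF e5] exec.Seq[OF e6] e7)
  ultimately show ?thesis
    using data by (intro exI[of _ s7]) (simp add: proj holds_data_def)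
qed

text \<open>
  Subtracts the dyads of the given vectors from \<open>B\<close>, which is zero at the start. This leaves the
  negative of the matrix of the frame operator; the multiple of the identity is added once its
  factor is known.
\<close>

definition Defect :: prog where
  "Defect = For ''q'' (IVar ''p'')
     (MatrixLoop ''l'' ''j'' (IVar ''n'') ''B''
        (SMinus (entry2 ''B'' ''l'' ''j'') (STimes (entry2 ''f'' ''q'' ''l'') (SCnj (entry2 ''f'' ''q'' ''j'')))))"

lemma exec_Defect:
  fixes s :: "'k::rc_field state"
  assumes n: "1 \<le> n" and sn: "fst s ''n'' = n" "fst s ''p'' = p"
    and f: "\<forall>i\<in>{1..p}. \<forall>j\<in>{1..n}. snd s ''f'' i j = x i j"
    and B: "snd s ''B'' = (\<lambda>_ _. 0)"
  shows "\<exists>t. exec Defect s t \<and>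
    (\<forall>y. y \<notin> {''q'', ''l'', ''j''} \<longrightarrow> fst t y = fst s y) \<and> (\<forall>A. A \<noteq> ''B'' \<longrightarrow> snd t A = snd s A) \<and>
    (\<forall>l\<in>{1..n}. \<forall>j\<in>{1..n}. snd t ''B'' l j = - (\<Sum>i=1..p. x i l * rc_cnj (x i j)))"
proof -
  define I where "I m t \<longleftrightarrow>
    (\<forall>y. y \<notin> {''q'', ''l'', ''j''} \<longrightarrow> fst t y = fst s y) \<and> (\<forall>A. A \<noteq> ''B'' \<longrightarrow> snd t A = snd s A) \<and>
    (\<forall>l\<in>{1..n}. \<forall>j\<in>{1..n}. snd t ''B'' l j = - (\<Sum>i=1..m. x i l * rc_cnj (x i j)))"
    for m :: nat and t :: "'k state"
  have "\<exists>t. exec Defect s t \<and> fst t ''q'' = Suc p \<and> I p t"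
    unfolding Defect_def
  proof (rule exec_For_invariant)
    show "I 0 s" by (simp add: I_def B)
  next
    fix i t assume i: "i < p" and I: "I i t"
    let ?s = "seti ''q'' (Suc i) t"
    let ?v = "\<lambda>l j. snd t ''B'' l j - x (Suc i) l * rc_cnj (x (Suc i) j)"
    let ?t = "seta ''B'' (\<lambda>l j. if l \<in> {1..n} \<and> j \<in> {1..n} then ?v l j else snd ?s ''B'' l j)
        (seti ''j'' (Suc n) (seti ''l'' (Suc n) ?s))"
    have tn: "fst t ''n'' = n" and tf: "snd t ''f'' = snd s ''f''"
      using I by (simp_all add: I_def sn)
    have "exec (MatrixLoop ''l'' ''j'' (IVar ''n'') ''B''
        (SMinus (entry2 ''B'' ''l'' ''j'') (STimes (entry2 ''f'' ''q'' ''l'') (SCnj (entry2 ''f'' ''q'' ''j''))))) ?s ?t"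
      by (rule exec_MatrixLoop) (use n i in \<open>simp_all add: tn tf f\<close>)
    moreover have "I (Suc i) ?t"
      using I by (simp add: I_def algebra_simps)
    ultimately show "\<exists>t'. exec (MatrixLoop ''l'' ''j'' (IVar ''n'') ''B''
        (SMinus (entry2 ''B'' ''l'' ''j'') (STimes (entry2 ''f'' ''q'' ''l'') (SCnj (entry2 ''f'' ''q'' ''j''))))) ?s t'
        \<and> fst t' ''q'' = Suc i \<and> I (Suc i) t'"
      by (intro exI[of _ ?t]) simp
  next
    fix i t c assume "I i t"
    then show "I i (seti ''q'' c t)" by (simp add: I_def)
  next
    fix i t assume "I i t"
    then show "ival (IVar ''p'') t = p" by (simp add: I_def sn)
  qed
  then show ?thesis unfolding I_def by blast
qed

text \<open>
  The variable \<open>A\<close> is the sum of the first \<open>r\<close> prescribed squared lengths, \<open>N\<close> is the dimension as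
  a scalar, and \<open>T\<close> is the negative of the trace of the frame operator.
\<close>

definition FindLength :: prog where
  "FindLength = While (SLess (scalar ''A'') (SPlus (STimes (scalar ''c'') (scalar ''N'')) (scalar ''T'')))
     (Seq (ISet ''r'' (IPlus (IVar ''r'') (INum 1)))
          (SetScalar ''A'' (SPlus (scalar ''A'') (SElem ''a'' (IVar ''r'') (INum 0)))))"

text \<open>
  The prescribed lengths are positive, so the partial sums increase and the loop cannot stop
  before the given \<open>r\<close>.
\<close>

lemma exec_FindLength:
  fixes s :: "'k::rc_field state"
  assumes a: "\<And>i. 1 \<le> i \<Longrightarrow> snd s ''a'' i 0 = of_real (a i)" and pos: "\<And>i. 1 \<le> i \<Longrightarrow> 0 < a i"
    and s0: "fst s ''r'' = 0" "snd s ''A'' 0 0 = 0"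
    and goal: "snd s ''c'' 0 0 * snd s ''N'' 0 0 + snd s ''T'' 0 0 = of_real \<tau>"
    and r: "1 \<le> r" "(\<Sum>i=1..r - 1. a i) < \<tau>" "\<tau> \<le> (\<Sum>i=1..r. a i)"
  shows "exec FindLength s (setcell ''A'' 0 0 (of_real (\<Sum>i=1..r. a i)) (seti ''r'' r s))"
proof -
  let ?b = "SLess (scalar ''A'') (SPlus (STimes (scalar ''c'') (scalar ''N'')) (scalar ''T''))"
  let ?S = "\<lambda>m. setcell ''A'' 0 0 (of_real (\<Sum>i=1..m. a i)) (seti ''r'' m s)"
  have b: "tdefined ?b (?S m)" "tval ?b (?S m) \<longleftrightarrow> (\<Sum>i=1..m. a i) < \<tau>" for m
    using goal by (simp_all add: rc_re_sum)
  have "exec FindLength (?S m) (?S r)" if "m \<le> r" for m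
    using that
  proof (induction m rule: inc_induct)
    case base
    have "\<not> tval ?b (?S r)" unfolding b(2) using r by simp
    then show ?case unfolding FindLength_def by (rule exec.WhileFalse[OF b(1)])
  next
    case (step m)
    have "(\<Sum>i=1..m. a i) \<le> (\<Sum>i=1..r - 1. a i)"
      using step by (intro sum_mono2) (auto intro: less_imp_le[OF pos])
    then have "tval ?b (?S m)" unfolding b(2) using r by simp
    moreover have "exec (Seq (ISet ''r'' (IPlus (IVar ''r'') (INum 1)))
        (SetScalar ''A'' (SPlus (scalar ''A'') (SElem ''a'' (IVar ''r'') (INum 0))))) (?S m) (?S (Suc m))"
    proof -
      let ?t = "seti ''r'' (Suc m) (?S m)"
      have "exec (ISet ''r'' (IPlus (IVar ''r'') (INum 1))) (?S m) ?t"
        by (rule exec_ISet) simp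
      moreover have "exec (SetScalar ''A'' (SPlus (scalar ''A'') (SElem ''a'' (IVar ''r'') (INum 0)))) ?t
          (setcell ''A'' 0 0 (of_real (\<Sum>i=1..Suc m. a i)) ?t)"
        by (rule exec_SSet) (simp_all add: a)
      ultimately show ?thesis by (auto intro: exec.Seq simp: seti_seta)
    qed
    ultimately show ?case
      using step.IH unfolding FindLength_def by (intro exec.WhileTrue[OF b(1)])
  qed
  from this[of 0] show ?thesis using s0 
    by (simp add: fun_upd_idem)
qed

text \<open>
  The constant is the sum of the traces of both frame operators, divided by the dimension.
\<close>

definition AddConstant :: prog where
  "AddConstant = For ''j'' (IVar ''n'') (SSet ''B'' (IVar ''j'') (IVar ''j'')
     (SPlus (entry2 ''B'' ''j'' ''j'') (SDivide (SMinus (scalar ''A'') (scalar ''T'')) (scalar ''N''))))"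

lemma exec_AddConstant:
  fixes s :: "'k::rc_field state"
  assumes n: "fst s ''n'' = n" and N: "snd s ''N'' 0 0 \<noteq> 0"
    and C: "(snd s ''A'' 0 0 - snd s ''T'' 0 0) / snd s ''N'' 0 0 = C"
  shows "exec AddConstant s (seta ''B''
    (\<lambda>l j. snd s ''B'' l j + (if l = j \<and> j \<in> {1..n} then C else 0)) (seti ''j'' (Suc n) s))"
proof -
  let ?S = "\<lambda>k. seta ''B'' (\<lambda>l j. snd s ''B'' l j + (if l = j \<and> j \<in> {1..k} then C else 0)) s"
  have "exec AddConstant s (seti ''j'' (Suc n) (?S n))"
    unfolding AddConstant_def
  proof (rule exec_For[where S = ?S])
    show "?S 0 = s" by simp
  next
    fix k assume "k < n"
    let ?t = "seti ''j'' (Suc k) (?S k)"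
    have "exec (SSet ''B'' (IVar ''j'') (IVar ''j'')
        (SPlus (entry2 ''B'' ''j'' ''j'') (SDivide (SMinus (scalar ''A'') (scalar ''T'')) (scalar ''N''))))
        ?t (setcell ''B'' (Suc k) (Suc k) (snd s ''B'' (Suc k) (Suc k) + C) ?t)"
      by (rule exec_SSet) (simp_all add: N C)
    moreover have "setcell ''B'' (Suc k) (Suc k) (snd s ''B'' (Suc k) (Suc k) + C) ?t
        = seti ''j'' (Suc k) (?S (Suc k))"
      unfolding seti_seta seta_simps by (rule arg_cong[of _ _ "\<lambda>M. seta _ M _"]) (auto simp: fun_eq_iff)
    ultimately show "exec (SSet ''B'' (IVar ''j'') (IVar ''j'')
        (SPlus (entry2 ''B'' ''j'' ''j'') (SDivide (SMinus (scalar ''A'') (scalar ''T'')) (scalar ''N''))))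
        ?t (seti ''j'' (Suc k) (?S (Suc k)))"
      by simp
  qed (simp add: n)
  then show ?thesis by (simp add: seti_seta)
qed

text \<open>
  The dimension has to be counted by a sum, because index variables cannot be used as scalars.
\<close>

definition Setup :: prog where
  "Setup =
     Seq Defect
    (Seq (SumLoop ''j'' (IVar ''n'') ''T'' (entry2 ''B'' ''j'' ''j''))
    (Seq (SumLoop ''j'' (IVar ''n'') ''N'' SOne)
    (Seq (Cond (SLess (SElem ''a'' (INum 1) (INum 0)) SOne)
            (SetScalar ''c'' (SPlus (scalar ''d'') SOne))
            (SetScalar ''c'' (SPlus (scalar ''d'') (SElem ''a'' (INum 1) (INum 0)))))
    (Seq FindLength AddConstant))))"

lemma exec_Setup:
  fixes x :: "nat \<Rightarrow> nat \<Rightarrow> 'k::rc_field"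
  assumes n: "1 \<le> n" and pos: "\<And>i. 1 \<le> i \<Longrightarrow> 0 < a i"
    and c: "c = max (d + 1) (d + a 1)"
    and r: "1 \<le> r" "(\<Sum>i=1..r - 1. a i) < c * real n - coord_trace n p x"
      "c * real n - coord_trace n p x \<le> (\<Sum>i=1..r. a i)"
    and C: "C = ((\<Sum>i=1..r. a i) + coord_trace n p x) / real n"
  shows "\<exists>t. exec Setup (input_with n p x a d) t \<and> holds_data n r a t \<and> fst t ''k'' = 0 \<and>
    snd t ''v'' 0 = (\<lambda>_. 0) \<and>
    (\<forall>l\<in>{1..n}. \<forall>j\<in>{1..n}. snd t ''B'' l j = defect_matrix p x C l j)"
proof -
  define s where "s = input_with n p x a d"
  define T where "T = coord_trace n p x"
  have s: "fst s ''n'' = n" "fst s ''p'' = p" "fst s ''r'' = 0" "fst s ''k'' = 0"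
    "\<And>i. 1 \<le> i \<Longrightarrow> snd s ''a'' i 0 = of_real (a i)" "snd s ''d'' 0 0 = of_real d"
    "snd s ''A'' 0 0 = 0" "snd s ''v'' = (\<lambda>_ _. 0)" "snd s ''B'' = (\<lambda>_ _. 0)"
    "\<forall>i\<in>{1..p}. \<forall>j\<in>{1..n}. snd s ''f'' i j = x i j"
    by (simp_all add: s_def input_with_def input_def)
  obtain s1 where e1: "exec Defect s s1"
    and s1': "\<forall>y. y \<notin> {''q'', ''l'', ''j''} \<longrightarrow> fst s1 y = fst s y" "\<forall>A. A \<noteq> ''B'' \<longrightarrow> snd s1 A = snd s A"
    and B1': "\<forall>l\<in>{1..n}. \<forall>j\<in>{1..n}. snd s1 ''B'' l j = - (\<Sum>i=1..p. x i l * rc_cnj (x i j))"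
    using exec_Defect[of n s p x, OF n s(1,2,10,9)] by (elim exE conjE)
  note s1 = s1'[rule_format] and B1 = B1'[rule_format]
  define s2 where "s2 = setcell ''T'' 0 0 (of_real (- T)) (seti ''j'' (Suc n) s1)"
  define s3 where "s3 = setcell ''N'' 0 0 (of_nat n) (seti ''j'' (Suc n) s2)"
  define s4 where "s4 = setcell ''c'' 0 0 (of_real c) s3"
  define s5 where "s5 = setcell ''A'' 0 0 (of_real (\<Sum>i=1..r. a i)) (seti ''r'' r s4)"
  define s6 where "s6 = seta ''B'' (\<lambda>l j. snd s5 ''B'' l j + (if l = j \<and> j \<in> {1..n} then of_real C else 0))
    (seti ''j'' (Suc n) s5)"
  have e2: "exec (SumLoop ''j'' (IVar ''n'') ''T'' (entry2 ''B'' ''j'' ''j'')) s1 s2"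
  proof -
    have "(\<Sum>j=1..n. snd s1 ''B'' j j) = of_real (- T)"
      by (simp add: B1 T_def coord_trace_def rc_mult_cnj_of_real sum_negf)
    moreover have "exec (SumLoop ''j'' (IVar ''n'') ''T'' (entry2 ''B'' ''j'' ''j'')) s1
        (setcell ''T'' 0 0 (\<Sum>j=1..n. snd s1 ''B'' j j) (seti ''j'' (Suc n) s1))"
      by (rule exec_SumLoop) (simp_all add: s1 s)
    ultimately show ?thesis by (simp add: s2_def)
  qed
  have e3: "exec (SumLoop ''j'' (IVar ''n'') ''N'' SOne) s2 s3"
  proof -
    have "exec (SumLoop ''j'' (IVar ''n'') ''N'' SOne) s2
        (setcell ''N'' 0 0 (\<Sum>j=1..n. 1) (seti ''j'' (Suc n) s2))"
      by (rule exec_SumLoop) (simp_all add: s2_def s1 s)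
    then show ?thesis by (simp add: s3_def)
  qed
  have e4: "exec (Cond (SLess (SElem ''a'' (INum 1) (INum 0)) SOne)
            (SetScalar ''c'' (SPlus (scalar ''d'') SOne))
            (SetScalar ''c'' (SPlus (scalar ''d'') (SElem ''a'' (INum 1) (INum 0))))) s3 s4"
  proof -
    have v: "snd s3 ''a'' 1 0 = of_real (a 1)" "snd s3 ''d'' 0 0 = of_real d"
      by (simp_all add: s3_def s2_def s1 s)
    show ?thesis
    proof (cases "a 1 < 1")
      case True
      then have "c = d + 1" using c by simp
      then show ?thesis unfolding s4_def using True v
        by (intro exec.CondTrue exec_SSet) simp_all
    next
      case False
      then have "c = d + a 1" using c by simp
      then show ?thesis unfolding s4_def using False v
        by (intro exec.CondFalse exec_SSet) simp_all
    qed
  qed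
  have e5: "exec FindLength s4 s5"
    unfolding s5_def
    by (rule exec_FindLength[OF _ pos, where \<tau> = "c * real n - T"])
      (use r in \<open>simp_all add: s4_def s3_def s2_def s1 s T_def\<close>)
  have e6: "exec AddConstant s5 s6"
    unfolding s6_def
    by (rule exec_AddConstant)
      (use n in \<open>simp_all add: s5_def s4_def s3_def s2_def s1 s C T_def\<close>)
  have "exec Setup s s6"
    unfolding Setup_def
    by (intro exec.Seq[OF e1] exec.Seq[OF e2] exec.Seq[OF e3] exec.Seq[OF e4] exec.Seq[OF e5] e6)
  moreover have "holds_data n r a s6" "fst s6 ''k'' = 0" "snd s6 ''v'' 0 = (\<lambda>_. 0)"
    by (simp_all add: holds_data_def s6_def s5_def s4_def s3_def s2_def s1 s)
  moreover have "snd s6 ''B'' l j = defect_matrix p x C l j" if "l \<in> {1..n}" "j \<in> {1..n}" for l j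
  proof -
    have "snd s5 ''B'' l j = - (\<Sum>i=1..p. x i l * rc_cnj (x i j))"
      using B1[OF that] by (simp add: s5_def s4_def s3_def s2_def)
    then show ?thesis using that by (simp add: s6_def defect_matrix_def)
  qed
  ultimately show ?thesis unfolding s_def by blast
qed

text \<open>
  The array \<open>v\<close> is zero at the start, which is the right initial leftover vector.
\<close>

definition Complete :: prog where
  "Complete = Seq Setup (For ''i'' (IVar ''r'') (Seq Select Rotate))"

lemma computes_Complete:
  fixes x :: "nat \<Rightarrow> nat \<Rightarrow> 'k::rc_field"
  assumes n: "1 \<le> n" and pos: "\<And>i. 1 \<le> i \<Longrightarrow> 0 < a i" and dec: "\<And>i. 1 \<le> i \<Longrightarrow> a (Suc i) \<le> a i"
    and c: "c = max (d + 1) (d + a 1)"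
    and r: "1 \<le> r" "(\<Sum>i=1..r - 1. a i) < c * real n - coord_trace n p x"
      "c * real n - coord_trace n p x \<le> (\<Sum>i=1..r. a i)"
    and C: "C = ((\<Sum>i=1..r. a i) + coord_trace n p x) / real n"
    and bound: "trailing_bounded_below n 0 (a 1) (defect_matrix p x C)"
  shows "\<exists>y. computes_vectors Complete (input_with n p x a d) r n y \<and>
    (\<forall>i\<in>{1..r}. sq_norm n (y i) = a i) \<and>
    (\<forall>l\<in>{1..n}. \<forall>j\<in>{1..n}. defect_matrix p x C l j = (\<Sum>q=1..r. y q l * rc_cnj (y q j)))"
proof -
  let ?A = "defect_matrix p x C"
  have tr: "(\<Sum>j=1..n. rc_re (?A j j)) = (\<Sum>q=1..r. a q)"
    unfolding defect_matrix_trace C using n by simp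
  have le: "a i \<le> a 1" if "1 \<le> i" for i
    using that by (induction i rule: dec_induct) (auto intro: order_trans[OF dec])
  obtain s where s: "exec Setup (input_with n p x a d) s" "holds_data n r a s" "fst s ''k'' = 0"
    "snd s ''v'' 0 = (\<lambda>_. 0)" "\<And>l j. l \<in> {1..n} \<Longrightarrow> j \<in> {1..n} \<Longrightarrow> snd s ''B'' l j = ?A l j"
    using exec_Setup[OF n pos c r C] by blast
  define I where "I m t \<longleftrightarrow> m \<le> r \<and> holds_data n r a t \<and>
    partial_decomposition n a ?A (Suc m) (fst t ''k'') (snd t ''v'' 0) (\<lambda>_. 0) (snd t ''B'') (snd t ''g'')"
    for m and t :: "'k state"
  have "\<exists>t. exec (For ''i'' (IVar ''r'') (Seq Select Rotate)) s t \<and> fst t ''i'' = Suc r \<and> I r t"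
  proof (rule exec_For_invariant)
    have "trailing_bounded_below n 0 (a 1) (snd s ''B'')"
      using trailing_bounded_below_cong[OF s(5)] bound by simp
    then show "I 0 s"
      using s by (simp add: I_def partial_decomposition_def)
  next
    fix i t assume i: "i < r" and I: "I i t"
    let ?s = "seti ''i'' (Suc i) t"
    have s0: "holds_data n r a ?s" "fst ?s ''i'' = Suc i" "Suc i \<in> {1..r}"
      "partial_decomposition n a ?A (Suc i) (fst ?s ''k'') (snd ?s ''v'' 0) (\<lambda>_. 0) (snd ?s ''B'') (snd ?s ''g'')"
      using I i by (simp_all add: I_def holds_data_def)
    obtain t1 where e1: "exec Select ?s t1" and t1: "holds_data n r a t1" "fst t1 ''i'' = Suc i"
      "snd t1 ''m'' 0 0 = of_real (sq_norm n (snd t1 ''v'' 0))"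
      "sq_norm n (snd t1 ''v'' 0) < a (Suc i)" "a (Suc i) \<le> sq_norm n (snd t1 ''w'' 0)"
      "partial_decomposition n a ?A (Suc i) (fst t1 ''k'') (snd t1 ''v'' 0) (snd t1 ''w'' 0) (snd t1 ''B'') (snd t1 ''g'')"
      using exec_Select[OF n s0 tr pos le[of "Suc i"]] by auto
    obtain t2 where "exec Rotate t1 t2" "holds_data n r a t2" "fst t2 ''i'' = Suc i"
      "partial_decomposition n a ?A (Suc (Suc i)) (fst t2 ''k'') (snd t2 ''v'' 0) (\<lambda>_. 0) (snd t2 ''B'') (snd t2 ''g'')"
      using exec_Rotate[OF t1(1,2) _ t1(3-6)] by auto
    with e1 i show "\<exists>t'. exec (Seq Select Rotate) ?s t' \<and> fst t' ''i'' = Suc i \<and> I (Suc i) t'"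
      unfolding I_def by (intro exI[of _ t2] conjI exec.Seq[of _ _ t1]) simp_all
  next
    fix i t c assume "I i t"
    then show "I i (seti ''i'' c t)" by (simp add: I_def holds_data_def)
  next
    fix i t assume "I i t"
    then show "ival (IVar ''r'') t = r" by (simp add: I_def holds_data_def)
  qed
  then obtain t where t: "exec (For ''i'' (IVar ''r'') (Seq Select Rotate)) s t" "holds_data n r a t"
    and P: "partial_decomposition n a ?A (Suc r) (fst t ''k'') (snd t ''v'' 0) (\<lambda>_. 0) (snd t ''B'') (snd t ''g'')"
    unfolding I_def by blast
  have "exec Complete (input_with n p x a d) t"
    unfolding Complete_def by (rule exec.Seq[OF s(1) t(1)])
  then have "computes_vectors Complete (input_with n p x a d) r n (snd t ''g'')"
    using t(2) unfolding computes_vectors_def by (intro exI[of _ t]) (simp add: holds_data_def)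
  moreover have "sq_norm n (snd t ''g'' i) = a i" if "i \<in> {1..r}" for i
    using P that by (simp add: partial_decomposition_def)
  moreover have "?A l j = (\<Sum>q=1..r. snd t ''g'' q l * rc_cnj (snd t ''g'' q j))"
    if "l \<in> {1..n}" "j \<in> {1..n}" for l j
    by (rule partial_decomposition_complete[OF P tr pos[of 1] that]) simp
  ultimately show ?thesis by blast
qed

theorem theoremC:
  shows "\<exists>P :: prog.
    \<forall>(scale :: 'k::rc_field \<Rightarrow> 'h::ab_group_add \<Rightarrow> 'h) (ip :: 'h \<Rightarrow> 'h \<Rightarrow> 'k)
      (n :: nat) (e :: nat \<Rightarrow> 'h) (p :: nat) (f :: nat \<Rightarrow> 'h) (a :: nat \<Rightarrow> real)
      (Q :: prog) (d :: real) (c :: real) (r :: nat).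
      hilbert_space_of_dim scale ip n \<longrightarrow>
      orthonormal_basis scale ip n e \<longrightarrow>
      (\<forall>i\<ge>1. 0 < a i) \<longrightarrow>
      (\<forall>i\<ge>1. a (Suc i) \<le> a i) \<longrightarrow>
      \<not> summable (\<lambda>i. a (Suc i)) \<longrightarrow>
      computes_real Q (input n p (\<lambda>i j. ip (f i) (e j)) a) d \<longrightarrow>
      op_norm ip (frame_operator scale ip p f) \<le> d \<longrightarrow>
      c = max (d + 1) (d + a 1) \<longrightarrow>
      1 \<le> r \<longrightarrow>
      (\<Sum>i=1..r - 1. a i) < c * real n - rc_re (op_trace ip n e (frame_operator scale ip p f)) \<longrightarrow>
      c * real n - rc_re (op_trace ip n e (frame_operator scale ip p f)) \<le> (\<Sum>i=1..r. a i) \<longrightarrow>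
      (\<exists>g :: nat \<Rightarrow> 'h.
         computes_vectors P (input_with n p (\<lambda>i j. ip (f i) (e j)) a d) r n
           (\<lambda>i j. ip (g i) (e j)) \<and>
         tight_frame scale ip (p + r) (concat_seq p f g) \<and>
         (\<forall>i\<in>{1..r}. (hnorm ip (g i))\<^sup>2 = a i))"
proof (rule exI[of _ Complete], intro allI impI)
  fix scale :: "'k \<Rightarrow> 'h \<Rightarrow> 'h" and ip :: "'h \<Rightarrow> 'h \<Rightarrow> 'k"
    and n p r :: nat and e f :: "nat \<Rightarrow> 'h" and a :: "nat \<Rightarrow> real" and Q :: prog and c d :: real
  assume H: "hilbert_space_of_dim scale ip n" and e: "orthonormal_basis scale ip n e"
    and pos: "\<forall>i\<ge>1. 0 < a i" and dec: "\<forall>i\<ge>1. a (Suc i) \<le> a i"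
    and d: "op_norm ip (frame_operator scale ip p f) \<le> d"
    and c: "c = max (d + 1) (d + a 1)" and r: "1 \<le> r"
      "(\<Sum>i=1..r - 1. a i) < c * real n - rc_re (op_trace ip n e (frame_operator scale ip p f))"
      "c * real n - rc_re (op_trace ip n e (frame_operator scale ip p f)) \<le> (\<Sum>i=1..r. a i)"
  interpret coordinates scale ip n e
    using H e by (simp add: coordinates_def coordinates_axioms_def hilbert_space_of_dim_def)
  have n: "1 \<le> n" using H by (simp add: hilbert_space_of_dim_def)
  define T where "T = coord_trace n p (coord f)"
  define C where "C = ((\<Sum>i=1..r. a i) + T) / real n"
  note r' = r[unfolded trace_frame_operator]
  \<comment> \<open>This is where the lower bound on the sum of the first r prescribed squared lengths is used.\<close>
  have cC: "c \<le> C"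
    using r'(3) n by (simp add: C_def T_def pos_le_divide_eq)
  have bound: "trailing_bounded_below n 0 (a 1) (defect_matrix p (coord f) C)"
    using d cC c by (intro defect_matrix_bounded_below[OF d]) simp
  have "ip (e 1) (e 1) = 1"
    using ip_basis[of 1 1] n by simp
  then have "e 1 \<noteq> 0"
    by (metis ip_zero_left zero_neq_one)
  then have "0 \<le> d"
    by (rule order_trans[OF op_norm_frame_operator_nonneg d])
  then have "0 < C"
    using c cC by linarith
  obtain y where y: "computes_vectors Complete (input_with n p (coord f) a d) r n y"
    and nrm: "\<And>i. i \<in> {1..r} \<Longrightarrow> sq_norm n (y i) = a i"
    and A: "\<And>l j. l \<in> {1..n} \<Longrightarrow> j \<in> {1..n} \<Longrightarrow>
      defect_matrix p (coord f) C l j = (\<Sum>q=1..r. y q l * rc_cnj (y q j))"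
    using computes_Complete[OF n pos[rule_format] dec[rule_format] c r' C_def[unfolded T_def] bound]
    by blast
  let ?g = "\<lambda>i. vec (y i)"
  show "\<exists>g. computes_vectors Complete (input_with n p (coord f) a d) r n (coord g) \<and>
      tight_frame scale ip (p + r) (concat_seq p f g) \<and> (\<forall>i\<in>{1..r}. (hnorm ip (g i))\<^sup>2 = a i)"
  proof (intro exI[of _ ?g] conjI ballI)
    show "computes_vectors Complete (input_with n p (coord f) a d) r n (coord ?g)"
      using y unfolding computes_vectors_def by (simp add: coord_vec)
    show "tight_frame scale ip (p + r) (concat_seq p f ?g)"
      by (rule tight_frame_of_dyads[OF \<open>0 < C\<close> A])
    show "(hnorm ip (?g i))\<^sup>2 = a i" if "i \<in> {1..r}" for i
      unfolding hnorm_sq ip_vec_self by (rule nrm[OF that])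
  qed
qed

end
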